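(* Let $S$ be an $\mathbb{R}^d$-valued, locally bounded, càdlàg semimartingale. Fix $q>1$ and put $p=\frac{q}{q-1}$. Then the following hold. (a) $\mathcal{M}^s(\mathbb{P})\cap L^q(\mathbb{P})\neq\emptyset$ if and only if $\bar K_0$ does not contain the constant function $1$. (b) Suppose $\mathcal{M}^s(\mathbb{P})\cap L^q(\mathbb{P})\neq\emptyset$. Let $f$ be the unique element of $\bar K_0$ with $$\|1-f\|_p=\inf_{h\in\bar K_0}\|1-h\|_p ,$$ and set $g^*:=\operatorname{sgn}(1-f)\,|1-f|^{p-1}$. Then the (signed) measure $\mathbb{Q}^*$ defined by $$\frac{d\mathbb{Q}^*}{d\mathbb{P}}:=\frac{g^*}{\mathbb{E}[g^*]}$$ is the unique element of minimal $L^q(\mathbb{P})$-norm among all $u\in\bar K_0^{\alpha}$ with $\mathbb{E}[u]=1$, i.e. it is the unique element of $\mathcal{M}^s(\mathbb{P})\cap L^q(\mathbb{P})$ with minimal $L^q(\mathbb{P})$-norm.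
   Context: $S=\{S_t\}_{t\ge0}$ is defined on a filtered probability space $(\Omega,\mathcal{F},\{\mathcal{F}_t\}_{t\ge0},\mathbb{P})$; $\mathbb{E}$ is expectation under $\mathbb{P}$. $K_0\subset L^\infty(\mathbb{P})$ is the linear span of all random variables $h=\phi\,(S_{\tau_2}-S_{\tau_1})$ (dot product in $\mathbb{R}^d$), where $\tau_1\le\tau_2$ a.s. are (finite-valued) stopping times such that the stopped process $S^{\tau_2}=\{S_{\tau_2\wedge t}\}_{t\ge0}$ is bounded, and $\phi$ is a bounded $\mathbb{R}^d$-valued $\mathcal{F}_{\tau_1}$-measurable function. The set of (densities of) signed local martingale measures is $$\mathcal{M}^s(\mathbb{P})=\{u\in L^1(\mathbb{P}):\ \mathbb{E}[uh]=0 \text{ for all } h\in K_0,\ \mathbb{E}[u]=1\};$$ signed measures are identified with their densities with respect to $\mathbb{P}$. $\bar K_0$ is the closure of $K_0$ in $L^p(\mathbb{P})$, and $\bar K_0^{\alpha}=\{u\in L^q(\mathbb{P}): \mathbb{E}[uh]=0\ \forall h\in\bar K_0\}$ is its annihilator. $\|\cdot\|_p,\|\cdot\|_q$ are the $L^p(\mathbb{P})$- and $L^q(\mathbb{P})$-norms, and $\operatorname{sgn}(0)=0$. *)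

theory Defs
  imports "HOL-Probability.Probability"
begin

section \<open>Processes on a filtered probability space\<close>

text \<open>The time set is \<open>[0,\<infinity>)\<close>, represented inside type \<^typ>\<open>real\<close>. A filtration indexed by
  \<open>[0,\<infinity>)\<close> extends to negative indices by its value at \<open>0\<close>. Nothing below depends on the
  extension: processes are only looked at for \<open>t \<ge> 0\<close>, and stopping times are required to be
  nonnegative, so that their defining condition is trivial at negative times. The usual conditions
  are not assumed.\<close>

locale filtered_prob_space = prob_space M + filtration "space M" F
  for M :: "'a measure" and F :: "real \<Rightarrow> 'a measure" +
  assumes subalgebra_F: "\<And>t. subalgebra M (F t)"

definition finite_stopping_time :: "'a measure \<Rightarrow> (real \<Rightarrow> 'a measure) \<Rightarrow> ('a \<Rightarrow> real) \<Rightarrow> bool" where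
  "finite_stopping_time M F \<tau> \<longleftrightarrow> stopping_time F \<tau> \<and> (\<forall>\<omega>\<in>space M. 0 \<le> \<tau> \<omega>)"

definition adapted_process ::
    "(real \<Rightarrow> 'a measure) \<Rightarrow> (real \<Rightarrow> 'a \<Rightarrow> 'b::topological_space) \<Rightarrow> bool" where
  "adapted_process F X \<longleftrightarrow> (\<forall>t\<ge>0. X t \<in> borel_measurable (F t))"

definition cadlag :: "(real \<Rightarrow> 'b::topological_space) \<Rightarrow> bool" where
  "cadlag x \<longleftrightarrow> (\<forall>t\<ge>0. (x \<longlongrightarrow> x t) (at_right t)) \<and> (\<forall>t>0. \<exists>l. (x \<longlongrightarrow> l) (at_left t))"

definition cadlag_process ::
    "'a measure \<Rightarrow> (real \<Rightarrow> 'a \<Rightarrow> 'b::topological_space) \<Rightarrow> bool" where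
  "cadlag_process M X \<longleftrightarrow> (\<forall>\<omega>\<in>space M. cadlag (\<lambda>t. X t \<omega>))"

definition stopped_process :: "(real \<Rightarrow> 'a \<Rightarrow> 'b) \<Rightarrow> ('a \<Rightarrow> real) \<Rightarrow> real \<Rightarrow> 'a \<Rightarrow> 'b" where
  "stopped_process X \<tau> = (\<lambda>t \<omega>. X (min (\<tau> \<omega>) t) \<omega>)"

definition bounded_process ::
    "'a measure \<Rightarrow> (real \<Rightarrow> 'a \<Rightarrow> 'b::real_normed_vector) \<Rightarrow> bool" where
  "bounded_process M X \<longleftrightarrow> (\<exists>C. AE \<omega> in M. \<forall>t\<ge>0. norm (X t \<omega>) \<le> C)"

text \<open>Restricting to finite stopping times is no loss: a localizing sequence \<open>\<tau>\<^sub>n\<close> with values in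
  \<open>[0,\<infinity>]\<close> can be replaced by \<open>min \<tau>\<^sub>n n\<close>.\<close>

definition localizing_sequence ::
    "'a measure \<Rightarrow> (real \<Rightarrow> 'a measure) \<Rightarrow> (nat \<Rightarrow> 'a \<Rightarrow> real) \<Rightarrow> bool" where
  "localizing_sequence M F \<tau> \<longleftrightarrow>
     (\<forall>n. finite_stopping_time M F (\<tau> n)) \<and>
     (AE \<omega> in M. incseq (\<lambda>n. \<tau> n \<omega>) \<and> filterlim (\<lambda>n. \<tau> n \<omega>) at_top sequentially)"

definition locally_bounded_process ::
    "'a measure \<Rightarrow> (real \<Rightarrow> 'a measure) \<Rightarrow> (real \<Rightarrow> 'a \<Rightarrow> 'b::real_normed_vector) \<Rightarrow> bool" where
  "locally_bounded_process M F X \<longleftrightarrow>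
     (\<exists>\<tau>. localizing_sequence M F \<tau> \<and> (\<forall>n. bounded_process M (stopped_process X (\<tau> n))))"

definition martingale ::
    "'a measure \<Rightarrow> (real \<Rightarrow> 'a measure) \<Rightarrow> (real \<Rightarrow> 'a \<Rightarrow> real) \<Rightarrow> bool" where
  "martingale M F X \<longleftrightarrow>
     adapted_process F X \<and> (\<forall>t\<ge>0. integrable M (X t)) \<and>
     (\<forall>s\<ge>0. \<forall>t\<ge>s. AE \<omega> in M. real_cond_exp M (F s) (X t) \<omega> = X s \<omega>)"

definition local_martingale ::
    "'a measure \<Rightarrow> (real \<Rightarrow> 'a measure) \<Rightarrow> (real \<Rightarrow> 'a \<Rightarrow> real) \<Rightarrow> bool" where
  "local_martingale M F X \<longleftrightarrow>
     adapted_process F X \<and> cadlag_process M X \<and>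
     (\<exists>\<tau>. localizing_sequence M F \<tau> \<and>
       (\<forall>n. martingale M F (\<lambda>t \<omega>. stopped_process X (\<tau> n) t \<omega> - X 0 \<omega>)))"

definition locally_finite_variation :: "(real \<Rightarrow> real) \<Rightarrow> bool" where
  "locally_finite_variation x \<longleftrightarrow>
     (\<forall>t\<ge>0. \<exists>C. \<forall>n (s::nat \<Rightarrow> real). incseq s \<longrightarrow> range s \<subseteq> {0..t} \<longrightarrow>
        (\<Sum>i<n. \<bar>x (s (Suc i)) - x (s i)\<bar>) \<le> C)"

definition finite_variation_process ::
    "'a measure \<Rightarrow> (real \<Rightarrow> 'a measure) \<Rightarrow> (real \<Rightarrow> 'a \<Rightarrow> real) \<Rightarrow> bool" where
  "finite_variation_process M F A \<longleftrightarrow>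
     adapted_process F A \<and> cadlag_process M A \<and>
     (\<forall>\<omega>\<in>space M. locally_finite_variation (\<lambda>t. A t \<omega>))"

definition real_semimartingale ::
    "'a measure \<Rightarrow> (real \<Rightarrow> 'a measure) \<Rightarrow> (real \<Rightarrow> 'a \<Rightarrow> real) \<Rightarrow> bool" where
  "real_semimartingale M F X \<longleftrightarrow>
     adapted_process F X \<and> cadlag_process M X \<and>
     (\<exists>N A. local_martingale M F N \<and> finite_variation_process M F A \<and>
        (\<forall>\<omega>\<in>space M. N 0 \<omega> = 0 \<and> A 0 \<omega> = 0) \<and>
        (AE \<omega> in M. \<forall>t\<ge>0. X t \<omega> = X 0 \<omega> + N t \<omega> + A t \<omega>))"

definition semimartingale ::
    "'a measure \<Rightarrow> (real \<Rightarrow> 'a measure) \<Rightarrow> (real \<Rightarrow> 'a \<Rightarrow> real ^ 'd) \<Rightarrow> bool" where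
  "semimartingale M F S \<longleftrightarrow> (\<forall>i. real_semimartingale M F (\<lambda>t \<omega>. S t \<omega> $ i))"


section \<open>The spaces \<open>L\<^sup>p\<close>\<close>

text \<open>Elements of \<open>L\<^sup>p\<close> are represented by functions; equality in \<open>L\<^sup>p\<close> is equality almost
  everywhere.\<close>

definition Lp_space :: "'a measure \<Rightarrow> real \<Rightarrow> ('a \<Rightarrow> real) set" where
  "Lp_space M p = {u \<in> borel_measurable M. integrable M (\<lambda>\<omega>. \<bar>u \<omega>\<bar> powr p)}"

definition Lp_norm :: "'a measure \<Rightarrow> real \<Rightarrow> ('a \<Rightarrow> real) \<Rightarrow> real" where
  "Lp_norm M p u = (\<integral>\<omega>. \<bar>u \<omega>\<bar> powr p \<partial>M) powr (1 / p)"

text \<open>Only meaningful on \<^const>\<open>Lp_space\<close>: if \<open>\<bar>u\<bar> powr p\<close> is not integrable, the value is \<open>0\<close>. Hence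
  the intersection with \<^const>\<open>Lp_space\<close> in the closure below.\<close>

definition Lp_closure :: "'a measure \<Rightarrow> real \<Rightarrow> ('a \<Rightarrow> real) set \<Rightarrow> ('a \<Rightarrow> real) set" where
  "Lp_closure M p K =
     {u \<in> Lp_space M p. \<forall>e>0. \<exists>h \<in> K \<inter> Lp_space M p. Lp_norm M p (\<lambda>\<omega>. u \<omega> - h \<omega>) < e}"

text \<open>The annihilator in \<open>L\<^sup>q\<close> of a set of elements of the dual exponent's space.\<close>

definition Lq_annihilator :: "'a measure \<Rightarrow> real \<Rightarrow> ('a \<Rightarrow> real) set \<Rightarrow> ('a \<Rightarrow> real) set" where
  "Lq_annihilator M q K = {u \<in> Lp_space M q. \<forall>h\<in>K. (\<integral>\<omega>. u \<omega> * h \<omega> \<partial>M) = 0}"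

definition unique_min_Lp_norm ::
    "'a measure \<Rightarrow> real \<Rightarrow> ('a \<Rightarrow> real) set \<Rightarrow> ('a \<Rightarrow> real) \<Rightarrow> bool" where
  "unique_min_Lp_norm M q C u \<longleftrightarrow>
     u \<in> C \<and> (\<forall>v\<in>C. Lp_norm M q u \<le> Lp_norm M q v) \<and>
     (\<forall>v\<in>C. Lp_norm M q v = Lp_norm M q u \<longrightarrow> (AE \<omega> in M. v \<omega> = u \<omega>))"


section \<open>Simple stochastic integrals and signed local martingale measures\<close>

definition simple_integrals ::
    "'a measure \<Rightarrow> (real \<Rightarrow> 'a measure) \<Rightarrow> (real \<Rightarrow> 'a \<Rightarrow> real ^ 'd) \<Rightarrow> ('a \<Rightarrow> real) set" where
  "simple_integrals M F S =
     {\<lambda>\<omega>. \<phi> \<omega> \<bullet> (S (\<tau>2 \<omega>) \<omega> - S (\<tau>1 \<omega>) \<omega>) | \<phi> \<tau>1 \<tau>2.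
        finite_stopping_time M F \<tau>1 \<and> finite_stopping_time M F \<tau>2 \<and>
        (AE \<omega> in M. \<tau>1 \<omega> \<le> \<tau>2 \<omega>) \<and>
        bounded_process M (stopped_process S \<tau>2) \<and>
        \<phi> \<in> borel_measurable (filtration.pre_sigma (space M) F \<tau>1) \<and>
        bounded (\<phi> ` space M)}"

definition linear_span :: "('a \<Rightarrow> real) set \<Rightarrow> ('a \<Rightarrow> real) set" where
  "linear_span G =
     {\<lambda>\<omega>. \<Sum>i<n. c i * g i \<omega> | (n::nat) (c::nat \<Rightarrow> real) g. \<forall>i<n. g i \<in> G}"

definition K0 ::
    "'a measure \<Rightarrow> (real \<Rightarrow> 'a measure) \<Rightarrow> (real \<Rightarrow> 'a \<Rightarrow> real ^ 'd) \<Rightarrow> ('a \<Rightarrow> real) set" where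
  "K0 M F S = linear_span (simple_integrals M F S)"

definition K0_bar ::
    "'a measure \<Rightarrow> (real \<Rightarrow> 'a measure) \<Rightarrow> (real \<Rightarrow> 'a \<Rightarrow> real ^ 'd) \<Rightarrow> real \<Rightarrow> ('a \<Rightarrow> real) set" where
  "K0_bar M F S p = Lp_closure M p (K0 M F S)"

text \<open>Signed measures absolutely continuous with respect to \<open>M\<close> are identified with their
  densities.\<close>

definition signed_local_martingale_measures ::
    "'a measure \<Rightarrow> (real \<Rightarrow> 'a measure) \<Rightarrow> (real \<Rightarrow> 'a \<Rightarrow> real ^ 'd) \<Rightarrow> ('a \<Rightarrow> real) set" where
  "signed_local_martingale_measures M F S =
     {u. integrable M u \<and> (\<forall>h \<in> K0 M F S. (\<integral>\<omega>. u \<omega> * h \<omega> \<partial>M) = 0) \<and> (\<integral>\<omega>. u \<omega> \<partial>M) = 1}"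

definition closest_to_one ::
    "'a measure \<Rightarrow> real \<Rightarrow> ('a \<Rightarrow> real) set \<Rightarrow> ('a \<Rightarrow> real) \<Rightarrow> bool" where
  "closest_to_one M p K f \<longleftrightarrow>
     f \<in> K \<and> Lp_norm M p (\<lambda>\<omega>. 1 - f \<omega>) = (INF h\<in>K. Lp_norm M p (\<lambda>\<omega>. 1 - h \<omega>))"

definition g_star :: "real \<Rightarrow> ('a \<Rightarrow> real) \<Rightarrow> 'a \<Rightarrow> real" where
  "g_star p f = (\<lambda>\<omega>. sgn (1 - f \<omega>) * \<bar>1 - f \<omega>\<bar> powr (p - 1))"

end

theory Submission
  imports Defs
begin

text \<open>Both extremal problems are governed by the strict tangent inequality
  \<open>\<bar>x\<bar> powr p > \<bar>y\<bar> powr p + p * sgn y * \<bar>y\<bar> powr (p - 1) * (x - y)\<close> for \<open>x \<noteq> y\<close>. Integrated along a variation of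
  the best approximation \<open>f\<close> of \<open>1\<close>, it shows that \<open>g\<^sup>*\<close> annihilates the closed subspace, so that
  \<open>E[g\<^sup>*] = E[g\<^sup>* (1 - f)]\<close> is the \<open>p\<close>-th power of the distance from \<open>1\<close> and is positive unless \<open>1\<close> is in the
  subspace. Integrated with exponent \<open>q\<close> at the normalized \<open>g\<^sup>*\<close>, it yields minimality and uniqueness at
  once. Existence of \<open>f\<close> comes from uniform convexity and completeness of \<open>L\<^sup>p\<close>. The link with the process
  is that elements of \<open>K\<^sub>0\<close> are measurable and almost surely bounded.\<close>

section \<open>Convexity of the absolute power\<close>

text \<open>Part (a) needs an element of L^q that annihilates the closed subspace and has nonzero
  expectation. It is not drawn from Hahn-Banach and Riesz representation but built explicitly: the
  normalized \<open>g_star\<close> is both the witness for (a) and the minimizer in (b). Both sets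
  in (b) coincide with the normalized annihilators, so all that is asked of \<open>S\<close> is that
  \<open>K0\<close> be a linear subspace of L^p. The argument runs on p-th moments, where the
  triangle inequality holds up to the factor \<open>2 powr p\<close>. That is enough for questions
  of smallness. Where the factor would hurt, as when passing to the limit of a minimizing sequence,
  the tangent inequality takes over.\<close>

text \<open>The derivative of \<open>x \<mapsto> \<bar>x\<bar> powr p\<close> is \<open>p * signed_powr (p - 1) x\<close>, and for conjugate exponents
  \<open>signed_powr (p - 1)\<close> and \<open>signed_powr (q - 1)\<close> are inverse to each other.\<close>

definition signed_powr :: "real \<Rightarrow> real \<Rightarrow> real" where
  "signed_powr r x = sgn x * \<bar>x\<bar> powr r"

lemma abs_signed_powr: "\<bar>signed_powr r x\<bar> = \<bar>x\<bar> powr r"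
  by (simp add: signed_powr_def abs_mult sgn_real_def)

lemma signed_powr_mult: "signed_powr r (x * y) = signed_powr r x * signed_powr r y"
  by (simp add: signed_powr_def abs_mult powr_mult sgn_mult)

lemma signed_powr_mult_self: "signed_powr (p - 1) x * x = \<bar>x\<bar> powr p"
proof (cases "x = 0")
  case False
  have "signed_powr (p - 1) x * x = \<bar>x\<bar> powr (p - 1) * \<bar>x\<bar> powr 1"
    using False by (simp add: signed_powr_def sgn_real_def)
  also have "\<dots> = \<bar>x\<bar> powr p"
    by (subst powr_add[symmetric]) simp
  finally show ?thesis .
qed simp

lemma signed_powr_signed_powr: "r * s = 1 \<Longrightarrow> signed_powr r (signed_powr s x) = x"
  by (simp add: signed_powr_def abs_mult sgn_mult abs_sgn_eq powr_powr powr_mult mult_ac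
      sgn_real_def)

text \<open>The sign jumps at 0, but there \<open>\<bar>y\<bar> powr r\<close> tends to 0, which
  damps the jump. Continuity is needed for the variational limit in
  \<open>best_approximation_orthogonal\<close>.\<close>

lemma continuous_signed_powr:
  assumes "0 < r"
  shows "isCont (signed_powr r) x"
proof (cases "x = 0")
  case True
  have "((\<lambda>y. \<bar>y\<bar> powr r) \<longlongrightarrow> \<bar>0\<bar> powr r) (at (0::real))"
    by (rule tendsto_powr'[OF _ tendsto_const]) (use assms in \<open>auto intro!: tendsto_rabs_zero tendsto_ident_at\<close>)
  then have "(signed_powr r \<longlongrightarrow> 0) (at 0)"
    by (intro tendsto_rabs_zero_cancel[where f = "signed_powr r"])
      (use assms in \<open>simp add: abs_signed_powr\<close>)
  then show ?thesis
    using True by (simp add: isCont_def signed_powr_def)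
next
  case False
  then show ?thesis
    unfolding isCont_def signed_powr_def by (auto intro!: tendsto_intros)
qed

lemma borel_measurable_signed_powr [measurable]: "signed_powr r \<in> borel_measurable borel"
  unfolding signed_powr_def by measurable

section \<open>Strict tangent inequality and midpoint convexity\<close>

text \<open>Strict Bernoulli inequality for a real exponent. Strictness stems from
  \<open>ln (1 / s) < 1 / s - 1\<close> for \<open>s \<noteq> 1\<close>; it is added to
  \<open>1 + (p - 1) * ln s \<le> s powr (p - 1)\<close>, and the sum is multiplied by
  \<open>s\<close>.\<close>

lemma powr_greater_tangent_at_1:
  fixes p s :: real
  assumes "1 < p" "0 < s" "s \<noteq> 1"
  shows "1 + p * (s - 1) < s powr p"
proof -
  have "ln (1 / s) < 1 / s - 1"
    using assms by (intro order.not_eq_order_implies_strict ln_le_minus_one)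
      (use ln_eq_minus_one[of "1 / s"] in auto)
  then have "(p - 1) * (1 - ln s) < (p - 1) * (1 / s)"
    using assms by (intro mult_strict_left_mono) (auto simp: ln_div)
  moreover have "1 + (p - 1) * ln s \<le> s powr (p - 1)"
    using assms exp_ge_add_one_self[of "(p - 1) * ln s"] by (simp add: powr_def)
  ultimately have "p < (p - 1) / s + s powr (p - 1)"
    by (simp add: algebra_simps)
  then have "s * p < s * ((p - 1) / s + s powr (p - 1))"
    using assms by simp
  also have "\<dots> = p - 1 + s powr 1 * s powr (p - 1)"
    using assms by (simp add: distrib_left)
  also have "\<dots> = p - 1 + s powr p"
    by (subst powr_add[symmetric]) simp
  finally show ?thesis by (simp add: algebra_simps)
qed

text \<open>Both sides are homogeneous of degree \<open>p\<close>, so dividing by \<open>y\<close>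
  reduces the claim to the tangent at 1. For \<open>s \<le> 0\<close> that tangent is already
  negative, and at \<open>y = 0\<close> the tangent is the zero line.\<close>

lemma abs_powr_greater_tangent:
  fixes p x y :: real
  assumes p: "1 < p" and "x \<noteq> y"
  shows "\<bar>y\<bar> powr p + p * (signed_powr (p - 1) y * (x - y)) < \<bar>x\<bar> powr p"
proof (cases "y = 0")
  case True
  then show ?thesis using assms by (simp add: signed_powr_def)
next
  case False
  define s where "s = x / y"
  have x: "x = s * y" and "s \<noteq> 1"
    using False assms by (auto simp: s_def)
  have s: "1 + p * (s - 1) < \<bar>s\<bar> powr p"
  proof (cases "0 < s")
    case True
    then show ?thesis using powr_greater_tangent_at_1[OF p True \<open>s \<noteq> 1\<close>] by simp
  next
    case False
    then have "p * (s - 1) \<le> p * (- 1)"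
      using p by (intro mult_left_mono) auto
    then have "1 + p * (s - 1) < 0" using p by simp
    also have "0 \<le> \<bar>s\<bar> powr p" by simp
    finally show ?thesis .
  qed
  have "\<bar>y\<bar> powr p + p * (signed_powr (p - 1) y * (x - y))
      = \<bar>y\<bar> powr p + p * (s - 1) * (signed_powr (p - 1) y * y)"
    by (simp add: x algebra_simps)
  also have "\<dots> = (1 + p * (s - 1)) * \<bar>y\<bar> powr p"
    unfolding signed_powr_mult_self by (simp add: algebra_simps)
  also have "\<dots> < \<bar>s\<bar> powr p * \<bar>y\<bar> powr p"
    using s False by (intro mult_strict_right_mono) auto
  also have "\<dots> = \<bar>x\<bar> powr p"
    by (simp add: x abs_mult powr_mult)
  finally show ?thesis .
qed

lemma abs_powr_ge_tangent:
  fixes p x y :: real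
  assumes "1 < p"
  shows "\<bar>y\<bar> powr p + p * (signed_powr (p - 1) y * (x - y)) \<le> \<bar>x\<bar> powr p"
  using abs_powr_greater_tangent[OF assms, of x y] by (cases "x = y") auto

text \<open>The tangent at the midpoint lies strictly below the function at both \<open>x\<close>
  and \<open>y\<close>; averaged over the two, its linear terms cancel.\<close>

lemma abs_powr_midpoint_less:
  fixes p x y :: real
  assumes p: "1 < p" and "x \<noteq> y"
  shows "\<bar>(x + y) / 2\<bar> powr p < (\<bar>x\<bar> powr p + \<bar>y\<bar> powr p) / 2"
proof -
  let ?m = "(x + y) / 2"
  have "\<bar>?m\<bar> powr p + p * (signed_powr (p - 1) ?m * (x - ?m)) < \<bar>x\<bar> powr p"
       "\<bar>?m\<bar> powr p + p * (signed_powr (p - 1) ?m * (y - ?m)) < \<bar>y\<bar> powr p"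
    using assms by (intro abs_powr_greater_tangent; simp add: field_simps)+
  moreover have "p * (signed_powr (p - 1) ?m * (y - ?m)) = - (p * (signed_powr (p - 1) ?m * (x - ?m)))"
    by (simp add: field_simps)
  ultimately show ?thesis by simp
qed

lemma abs_powr_midpoint_le:
  fixes p x y :: real
  assumes "1 < p"
  shows "\<bar>(x + y) / 2\<bar> powr p \<le> (\<bar>x\<bar> powr p + \<bar>y\<bar> powr p) / 2"
  using abs_powr_midpoint_less[OF assms, of x y] by (cases "x = y") auto

section \<open>Pointwise uniform convexity\<close>

text \<open>Near \<open>s = 1\<close> the left side is below \<open>e\<close> by itself. Away from 1
  the convexity gap has a positive minimum on a compact interval, and a large multiple of it beats
  the left side. This treats all \<open>p > 1\<close> alike, with no case distinction at
  \<open>p = 2\<close> as in Clarkson's inequalities.\<close>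

lemma abs_powr_uniformly_convex_normalized:
  fixes p e :: real
  assumes p: "1 < p" and "0 < e"
  obtains C where "0 \<le> C"
    "\<And>s. \<bar>s\<bar> \<le> 1 \<Longrightarrow>
       \<bar>s - 1\<bar> powr p \<le> e + C * ((\<bar>s\<bar> powr p + 1) / 2 - \<bar>(s + 1) / 2\<bar> powr p)"
proof -
  define G where "G s = (\<bar>s\<bar> powr p + 1) / 2 - \<bar>(s + 1) / 2\<bar> powr p" for s :: real
  \<comment> \<open>The cap at 1 keeps the interval \<open>{-1 .. 1 - \<eta>}\<close>
    nonempty.\<close>
  define \<eta> where "\<eta> = min 1 (e powr (1 / p))"
  have \<eta>: "0 < \<eta>" "\<eta> \<le> 1"
    using assms by (auto simp: \<eta>_def)
  have "\<eta> powr p \<le> (e powr (1 / p)) powr p"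
    using p \<eta> by (intro powr_mono2) (auto simp: \<eta>_def)
  then have \<eta>p: "\<eta> powr p \<le> e"
    using assms by (simp add: powr_powr)
  have cont: "continuous_on {-1 .. 1 - \<eta>} G"
    unfolding G_def using p by (auto intro!: continuous_intros continuous_on_powr')
  obtain s0 where s0: "s0 \<in> {-1 .. 1 - \<eta>}" "\<And>s. s \<in> {-1 .. 1 - \<eta>} \<Longrightarrow> G s0 \<le> G s"
    using continuous_attains_inf[OF compact_Icc _ cont] \<eta> by auto
  have "s0 \<noteq> 1" using s0 \<eta> by auto
  then have G0: "0 < G s0"
    using abs_powr_midpoint_less[OF p, of s0 1] by (simp add: G_def)
  have G_nonneg: "0 \<le> G s" for s
    using abs_powr_midpoint_le[OF p, of s 1] by (simp add: G_def)
  \<comment> \<open>\<open>2 powr p\<close> is the largest value of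
    \<open>\<bar>s - 1\<bar> powr p\<close> on \<open>[-1, 1]\<close>, and \<open>G s0\<close> the
    smallest gap on the compact part.\<close>
  define C where "C = 2 powr p / G s0"
  have C: "0 \<le> C" using G0 by (simp add: C_def)
  have "\<bar>s - 1\<bar> powr p \<le> e + C * G s" if s: "\<bar>s\<bar> \<le> 1" for s :: real
  proof (cases "s \<le> 1 - \<eta>")
    case True
    have "\<bar>s - 1\<bar> powr p \<le> 2 powr p"
      using s p by (intro powr_mono2) auto
    also have "\<dots> = C * G s0"
      using G0 by (simp add: C_def)
    also have "\<dots> \<le> C * G s"
      using s True C by (intro mult_left_mono s0) auto
    finally show ?thesis using \<open>0 < e\<close> by simp
  next
    case False
    then have "\<bar>s - 1\<bar> powr p \<le> \<eta> powr p"
      using s p by (intro powr_mono2) auto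
    then show ?thesis
      using \<eta>p mult_nonneg_nonneg[OF C G_nonneg[of s]] by simp
  qed
  with C show ?thesis by (intro that[of C]) (auto simp: G_def)
qed

text \<open>The case \<open>y = 1\<close> extends by homogeneity.\<close>

lemma abs_powr_uniformly_convex:
  fixes p e :: real
  assumes p: "1 < p" and "0 < e"
  obtains C where "0 \<le> C"
    "\<And>x y. \<bar>x - y\<bar> powr p \<le> e * (\<bar>x\<bar> powr p + \<bar>y\<bar> powr p)
       + C * ((\<bar>x\<bar> powr p + \<bar>y\<bar> powr p) / 2 - \<bar>(x + y) / 2\<bar> powr p)"
proof -
  obtain C where C: "0 \<le> C"
    "\<And>s. \<bar>s\<bar> \<le> 1 \<Longrightarrow>
       \<bar>s - 1\<bar> powr p \<le> e + C * ((\<bar>s\<bar> powr p + 1) / 2 - \<bar>(s + 1) / 2\<bar> powr p)"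
    using abs_powr_uniformly_convex_normalized[OF assms] by metis
  have le: "\<bar>x - y\<bar> powr p \<le> e * (\<bar>x\<bar> powr p + \<bar>y\<bar> powr p)
       + C * ((\<bar>x\<bar> powr p + \<bar>y\<bar> powr p) / 2 - \<bar>(x + y) / 2\<bar> powr p)"
    if "\<bar>x\<bar> \<le> \<bar>y\<bar>" for x y :: real
  proof (cases "y = 0")
    case True
    then show ?thesis using that by simp
  next
    case False
    define s where "s = x / y"
    have x: "x = s * y" and s: "\<bar>s\<bar> \<le> 1"
      using False that by (auto simp: s_def abs_divide)
    have "\<bar>x - y\<bar> powr p = \<bar>s - 1\<bar> powr p * \<bar>y\<bar> powr p"
      by (simp add: x powr_mult[symmetric] abs_mult[symmetric] algebra_simps)
    also have "\<dots> \<le> (e + C * ((\<bar>s\<bar> powr p + 1) / 2 - \<bar>(s + 1) / 2\<bar> powr p)) * \<bar>y\<bar> powr p"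
      using C(2)[OF s] by (rule mult_right_mono) simp
    also have "\<dots> = e * \<bar>y\<bar> powr p
       + C * ((\<bar>s\<bar> powr p * \<bar>y\<bar> powr p + \<bar>y\<bar> powr p) / 2 - \<bar>(s + 1) / 2\<bar> powr p * \<bar>y\<bar> powr p)"
      by (simp add: field_simps)
    also have "\<bar>s\<bar> powr p * \<bar>y\<bar> powr p = \<bar>x\<bar> powr p"
      by (simp add: x abs_mult powr_mult)
    also have "\<bar>(s + 1) / 2\<bar> powr p * \<bar>y\<bar> powr p = \<bar>(x + y) / 2\<bar> powr p"
      by (simp add: x powr_mult[symmetric] abs_mult[symmetric] algebra_simps)
    finally show ?thesis
      using \<open>0 < e\<close> by (simp add: algebra_simps add_increasing)
  qed
  show ?thesis
  proof (rule that[OF C(1)])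
    fix x y :: real
    show "\<bar>x - y\<bar> powr p \<le> e * (\<bar>x\<bar> powr p + \<bar>y\<bar> powr p)
       + C * ((\<bar>x\<bar> powr p + \<bar>y\<bar> powr p) / 2 - \<bar>(x + y) / 2\<bar> powr p)"
      using le[of x y] le[of y x] by (cases "\<bar>x\<bar> \<le> \<bar>y\<bar>") (auto simp: abs_minus_commute add.commute)
  qed
qed

text \<open>Crude, by \<open>\<bar>x + y\<bar> \<le> 2 * max \<bar>x\<bar> \<bar>y\<bar>\<close>,
  but sufficient for integrability and for errors that only have to become small.\<close>

lemma abs_add_powr_le:
  fixes x y p :: real
  assumes "0 \<le> p"
  shows "\<bar>x + y\<bar> powr p \<le> 2 powr p * (\<bar>x\<bar> powr p + \<bar>y\<bar> powr p)"
proof -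
  have "\<bar>x + y\<bar> powr p \<le> (2 * max \<bar>x\<bar> \<bar>y\<bar>) powr p"
    using assms by (intro powr_mono2) auto
  also have "\<dots> = 2 powr p * max \<bar>x\<bar> \<bar>y\<bar> powr p"
    by (simp add: powr_mult)
  also have "max \<bar>x\<bar> \<bar>y\<bar> powr p \<le> \<bar>x\<bar> powr p + \<bar>y\<bar> powr p"
    by (simp add: max_def)
  finally show ?thesis by simp
qed

text \<open>Young's inequality with its weights \<open>1 / q\<close> and \<open>1 / p\<close>
  bounded by 1.\<close>

lemma abs_mult_le_powr_add_powr:
  fixes p q x y :: real
  assumes pq: "1 < p" "1 < q" "1 / p + 1 / q = 1"
  shows "\<bar>x * y\<bar> \<le> \<bar>x\<bar> powr q + \<bar>y\<bar> powr p"
proof -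
  have "\<bar>x\<bar> * \<bar>y\<bar> \<le> \<bar>x\<bar> powr q / q + \<bar>y\<bar> powr p / p"
    using pq by (intro Youngs_inequality) auto
  also have "\<dots> \<le> \<bar>x\<bar> powr q + \<bar>y\<bar> powr p"
    using pq mult_right_mono[of 1 q "\<bar>x\<bar> powr q"] mult_right_mono[of 1 p "\<bar>y\<bar> powr p"]
    by (intro add_mono) (auto simp: divide_le_eq mult.commute)
  finally show ?thesis by (simp add: abs_mult)
qed

section \<open>Subspaces and closures in \<open>L\<^sup>p\<close>\<close>

lemma Lp_spaceI:
  "u \<in> borel_measurable M \<Longrightarrow> integrable M (\<lambda>\<omega>. \<bar>u \<omega>\<bar> powr p) \<Longrightarrow> u \<in> Lp_space M p"
  by (simp add: Lp_space_def)

lemma Lp_spaceD: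
  assumes "u \<in> Lp_space M p"
  shows "u \<in> borel_measurable M" "integrable M (\<lambda>\<omega>. \<bar>u \<omega>\<bar> powr p)"
  using assms by (auto simp: Lp_space_def)

lemma Lp_space_cmult:
  assumes "u \<in> Lp_space M p"
  shows "(\<lambda>\<omega>. c * u \<omega>) \<in> Lp_space M p"
  using Lp_spaceD[OF assms] by (intro Lp_spaceI) (auto simp: abs_mult powr_mult)

lemma Lp_space_add:
  assumes p: "0 \<le> p" and u: "u \<in> Lp_space M p" and v: "v \<in> Lp_space M p"
  shows "(\<lambda>\<omega>. u \<omega> + v \<omega>) \<in> Lp_space M p"
proof (rule Lp_spaceI)
  note [measurable] = Lp_spaceD(1)[OF u] Lp_spaceD(1)[OF v]
  show "integrable M (\<lambda>\<omega>. \<bar>u \<omega> + v \<omega>\<bar> powr p)"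
    by (rule Bochner_Integration.integrable_bound
        [of M "\<lambda>\<omega>. 2 powr p * (\<bar>u \<omega>\<bar> powr p + \<bar>v \<omega>\<bar> powr p)"])
      (use abs_add_powr_le[OF p] Lp_spaceD[OF u] Lp_spaceD[OF v] in auto)
qed (use Lp_spaceD[OF u] Lp_spaceD[OF v] in auto)

lemma Lp_space_lincomb:
  assumes "0 \<le> p" "u \<in> Lp_space M p" "v \<in> Lp_space M p"
  shows "(\<lambda>\<omega>. a * u \<omega> + b * v \<omega>) \<in> Lp_space M p"
  by (intro Lp_space_add Lp_space_cmult assms)

lemma Lp_space_diff:
  assumes "0 \<le> p" "u \<in> Lp_space M p" "v \<in> Lp_space M p"
  shows "(\<lambda>\<omega>. u \<omega> - v \<omega>) \<in> Lp_space M p"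
  using Lp_space_lincomb[OF assms, of 1 "-1"] by simp

lemma (in finite_measure) Lp_space_bounded:
  assumes "0 \<le> p" and [measurable]: "u \<in> borel_measurable M" and "AE \<omega> in M. \<bar>u \<omega>\<bar> \<le> C"
  shows "u \<in> Lp_space M p"
proof (rule Lp_spaceI)
  show "integrable M (\<lambda>\<omega>. \<bar>u \<omega>\<bar> powr p)"
    by (rule integrable_const_bound[where B = "C powr p"])
      (use assms in \<open>auto elim!: eventually_mono intro: powr_mono2\<close>)
qed fact

text \<open>Working with the \<open>p\<close>-th power of the norm avoids Minkowski's inequality.\<close>

abbreviation Lp_moment :: "'a measure \<Rightarrow> real \<Rightarrow> ('a \<Rightarrow> real) \<Rightarrow> real" where
  "Lp_moment M p u \<equiv> \<integral>\<omega>. \<bar>u \<omega>\<bar> powr p \<partial>M"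

lemma Lp_moment_cmult: "Lp_moment M p (\<lambda>\<omega>. c * u \<omega>) = \<bar>c\<bar> powr p * Lp_moment M p u"
  by (simp add: abs_mult powr_mult)

lemma Lp_moment_add_le:
  assumes p: "0 \<le> p" and u: "u \<in> Lp_space M p" and v: "v \<in> Lp_space M p"
  shows "Lp_moment M p (\<lambda>\<omega>. u \<omega> + v \<omega>) \<le> 2 powr p * (Lp_moment M p u + Lp_moment M p v)"
proof -
  have "Lp_moment M p (\<lambda>\<omega>. u \<omega> + v \<omega>) \<le> (\<integral>\<omega>. 2 powr p * (\<bar>u \<omega>\<bar> powr p + \<bar>v \<omega>\<bar> powr p) \<partial>M)"
    using Lp_spaceD[OF u] Lp_spaceD[OF v] Lp_spaceD[OF Lp_space_add[OF assms]]
    by (intro integral_mono abs_add_powr_le p) auto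
  then show ?thesis
    using Lp_spaceD[OF u] Lp_spaceD[OF v] by simp
qed

lemma Lp_norm_nonneg: "0 \<le> Lp_norm M p u"
  by (simp add: Lp_norm_def)

lemma powr_less_powr_iff:
  fixes a b r :: real
  assumes "0 \<le> a" "0 \<le> b" "0 < r"
  shows "a powr r < b powr r \<longleftrightarrow> a < b"
  using powr_less_mono2[of r a b] powr_mono2[of r b a] assms
  by (cases "a < b") auto

lemma Lp_norm_le_iff:
  assumes "0 < p"
  shows "Lp_norm M p u \<le> Lp_norm M p v \<longleftrightarrow> Lp_moment M p u \<le> Lp_moment M p v"
  unfolding Lp_norm_def not_less[symmetric]
  using assms by (subst powr_less_powr_iff) simp_all

lemma Lp_norm_less_iff:
  assumes p: "0 < p" and e: "0 < e"
  shows "Lp_norm M p u < e \<longleftrightarrow> Lp_moment M p u < e powr p"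
proof -
  have "Lp_norm M p u < e \<longleftrightarrow> Lp_moment M p u powr (1 / p) < (e powr p) powr (1 / p)"
    using assms by (simp add: Lp_norm_def powr_powr)
  also have "\<dots> \<longleftrightarrow> Lp_moment M p u < e powr p"
    using assms by (subst powr_less_powr_iff) simp_all
  finally show ?thesis .
qed

section \<open>Closures and closed subspaces\<close>

text \<open>As \<open>e\<close> runs through the positive reals, so does \<open>e powr p\<close>;
  hence norm and moment define the same closure.\<close>

lemma Lp_closure_iff:
  assumes p: "0 < p"
  shows "u \<in> Lp_closure M p K \<longleftrightarrow> u \<in> Lp_space M p \<and>
    (\<forall>e>0. \<exists>h \<in> K \<inter> Lp_space M p. Lp_moment M p (\<lambda>\<omega>. u \<omega> - h \<omega>) < e)"
proof -
  have "(\<forall>e>0. \<exists>h \<in> K \<inter> Lp_space M p. Lp_norm M p (\<lambda>\<omega>. u \<omega> - h \<omega>) < e)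
      \<longleftrightarrow> (\<forall>e>0. \<exists>h \<in> K \<inter> Lp_space M p. Lp_moment M p (\<lambda>\<omega>. u \<omega> - h \<omega>) < e powr p)"
    using p by (simp add: Lp_norm_less_iff)
  also have "\<dots> \<longleftrightarrow> (\<forall>e>0. \<exists>h \<in> K \<inter> Lp_space M p. Lp_moment M p (\<lambda>\<omega>. u \<omega> - h \<omega>) < e)"
  proof (intro iffI allI impI)
    fix e :: real
    assume *: "\<forall>e>0. \<exists>h \<in> K \<inter> Lp_space M p. Lp_moment M p (\<lambda>\<omega>. u \<omega> - h \<omega>) < e powr p"
      and e: "0 < e"
    have "(e powr (1 / p)) powr p = e"
      using p e by (simp add: powr_powr)
    with *[rule_format, of "e powr (1 / p)"] e
    show "\<exists>h \<in> K \<inter> Lp_space M p. Lp_moment M p (\<lambda>\<omega>. u \<omega> - h \<omega>) < e"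
      by simp
  next
    fix e :: real
    assume *: "\<forall>e>0. \<exists>h \<in> K \<inter> Lp_space M p. Lp_moment M p (\<lambda>\<omega>. u \<omega> - h \<omega>) < e"
      and "0 < e"
    then show "\<exists>h \<in> K \<inter> Lp_space M p. Lp_moment M p (\<lambda>\<omega>. u \<omega> - h \<omega>) < e powr p"
      by simp
  qed
  finally show ?thesis by (simp add: Lp_closure_def)
qed

lemma Lp_closure_subset_Lp_space: "Lp_closure M p K \<subseteq> Lp_space M p"
  by (auto simp: Lp_closure_def)

lemma subset_Lp_closure:
  assumes "0 < p" "K \<subseteq> Lp_space M p"
  shows "K \<subseteq> Lp_closure M p K"
proof
  fix h assume "h \<in> K"
  then show "h \<in> Lp_closure M p K"
    using assms by (auto simp: Lp_closure_iff intro!: bexI[of _ h])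
qed

text \<open>The moment does not see null sets, so such a \<open>K\<close> is saturated: with
  \<open>h\<close> it contains every member of \<open>Lp_space M p\<close> that equals
  \<open>h\<close> almost everywhere.\<close>

definition Lp_closed :: "'a measure \<Rightarrow> real \<Rightarrow> ('a \<Rightarrow> real) set \<Rightarrow> bool" where
  "Lp_closed M p K \<longleftrightarrow> K \<subseteq> Lp_space M p \<and>
     (\<forall>u\<in>Lp_space M p. (\<forall>e>0. \<exists>h\<in>K. Lp_moment M p (\<lambda>\<omega>. u \<omega> - h \<omega>) < e) \<longrightarrow> u \<in> K)"

lemma Lp_closed_Lp_closure:
  assumes p: "0 < p"
  shows "Lp_closed M p (Lp_closure M p K)"
  unfolding Lp_closed_def
proof (intro conjI ballI impI Lp_closure_subset_Lp_space)
  fix u assume u: "u \<in> Lp_space M p"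
    and approx: "\<forall>e>0. \<exists>h\<in>Lp_closure M p K. Lp_moment M p (\<lambda>\<omega>. u \<omega> - h \<omega>) < e"
  show "u \<in> Lp_closure M p K"
    unfolding Lp_closure_iff[OF p]
  proof (intro conjI u allI impI)
    fix e :: real assume "0 < e"
    \<comment> \<open>Two errors below \<open>d\<close> add up to less than \<open>e\<close> after
      the factor \<open>2 powr p\<close>.\<close>
    define d where "d = e / (2 * 2 powr p)"
    have d: "0 < d" using \<open>0 < e\<close> by (simp add: d_def)
    obtain h where h: "h \<in> Lp_closure M p K" "Lp_moment M p (\<lambda>\<omega>. u \<omega> - h \<omega>) < d"
      using approx d by blast
    obtain k where k: "k \<in> K \<inter> Lp_space M p" "Lp_moment M p (\<lambda>\<omega>. h \<omega> - k \<omega>) < d"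
      using h(1) d by (auto simp: Lp_closure_iff[OF p])
    have hL: "h \<in> Lp_space M p" using h(1) Lp_closure_subset_Lp_space by auto
    have "Lp_moment M p (\<lambda>\<omega>. (u \<omega> - h \<omega>) + (h \<omega> - k \<omega>))
        \<le> 2 powr p * (Lp_moment M p (\<lambda>\<omega>. u \<omega> - h \<omega>) + Lp_moment M p (\<lambda>\<omega>. h \<omega> - k \<omega>))"
      using p u hL k by (intro Lp_moment_add_le Lp_space_diff) auto
    also have "\<dots> < 2 powr p * (d + d)"
      using h k by (intro mult_strict_left_mono add_strict_mono) auto
    also have "\<dots> = e" by (simp add: d_def)
    finally show "\<exists>h\<in>K \<inter> Lp_space M p. Lp_moment M p (\<lambda>\<omega>. u \<omega> - h \<omega>) < e"
      using k by auto
  qed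
qed

definition linear_subspace :: "('a \<Rightarrow> real) set \<Rightarrow> bool" where
  "linear_subspace K \<longleftrightarrow> K \<noteq> {} \<and> (\<forall>u\<in>K. \<forall>v\<in>K. \<forall>a b. (\<lambda>\<omega>. a * u \<omega> + b * v \<omega>) \<in> K)"

lemma linear_subspaceD:
  assumes "linear_subspace K" "u \<in> K" "v \<in> K"
  shows "(\<lambda>\<omega>. a * u \<omega> + b * v \<omega>) \<in> K"
  using assms by (simp add: linear_subspace_def)

lemma linear_subspace_Lp_closure:
  assumes p: "0 < p" and K: "linear_subspace K" "K \<subseteq> Lp_space M p"
  shows "linear_subspace (Lp_closure M p K)"
  unfolding linear_subspace_def
proof (intro conjI ballI allI)
  show "Lp_closure M p K \<noteq> {}"
    using subset_Lp_closure[OF p K(2)] K(1) by (auto simp: linear_subspace_def)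
  fix u v and a b :: real
  assume uv: "u \<in> Lp_closure M p K" "v \<in> Lp_closure M p K"
  then have L: "u \<in> Lp_space M p" "v \<in> Lp_space M p"
    using Lp_closure_subset_Lp_space by auto
  show "(\<lambda>\<omega>. a * u \<omega> + b * v \<omega>) \<in> Lp_closure M p K"
    unfolding Lp_closure_iff[OF p]
  proof (intro conjI allI impI)
    show "(\<lambda>\<omega>. a * u \<omega> + b * v \<omega>) \<in> Lp_space M p"
      using p L by (intro Lp_space_lincomb) auto
    fix e :: real assume "0 < e"
    \<comment> \<open>The summand 1 keeps \<open>D\<close> positive for \<open>a = b = 0\<close> and
      makes the final estimate strict.\<close>
    define D where "D = 2 powr p * (\<bar>a\<bar> powr p + \<bar>b\<bar> powr p + 1)"
    have D: "0 < D" by (simp add: D_def add_nonneg_pos)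
    then have "0 < e / D" using \<open>0 < e\<close> by simp
    then obtain h k where h: "h \<in> K" "Lp_moment M p (\<lambda>\<omega>. u \<omega> - h \<omega>) < e / D"
      and k: "k \<in> K" "Lp_moment M p (\<lambda>\<omega>. v \<omega> - k \<omega>) < e / D"
      using uv unfolding Lp_closure_iff[OF p] by blast
    have hk: "h \<in> Lp_space M p" "k \<in> Lp_space M p" using h k K by auto
    have "Lp_moment M p (\<lambda>\<omega>. a * u \<omega> + b * v \<omega> - (a * h \<omega> + b * k \<omega>))
        = Lp_moment M p (\<lambda>\<omega>. a * (u \<omega> - h \<omega>) + b * (v \<omega> - k \<omega>))"
      by (simp add: algebra_simps)
    also have "\<dots> \<le> 2 powr p * (Lp_moment M p (\<lambda>\<omega>. a * (u \<omega> - h \<omega>)) + Lp_moment M p (\<lambda>\<omega>. b * (v \<omega> - k \<omega>)))"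
      using p L hk by (intro Lp_moment_add_le Lp_space_cmult Lp_space_diff) auto
    also have "\<dots> = 2 powr p * (\<bar>a\<bar> powr p * Lp_moment M p (\<lambda>\<omega>. u \<omega> - h \<omega>)
        + \<bar>b\<bar> powr p * Lp_moment M p (\<lambda>\<omega>. v \<omega> - k \<omega>))"
      by (simp only: Lp_moment_cmult)
    also have "\<dots> \<le> 2 powr p * (\<bar>a\<bar> powr p * (e / D) + \<bar>b\<bar> powr p * (e / D))"
      using h k by (intro mult_left_mono add_mono) auto
    also have "\<dots> < 2 powr p * (\<bar>a\<bar> powr p + \<bar>b\<bar> powr p + 1) * (e / D)"
      using mult_pos_pos[OF _ \<open>0 < e / D\<close>, of "2 powr p"]
      by (simp add: distrib_left distrib_right add_divide_distrib mult.assoc)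
    also have "\<dots> = e"
      using D by (simp flip: D_def)
    finally show "\<exists>h\<in>K \<inter> Lp_space M p. Lp_moment M p (\<lambda>\<omega>. a * u \<omega> + b * v \<omega> - h \<omega>) < e"
      using h k hk K(1) unfolding linear_subspace_def
      by (intro bexI[of _ "\<lambda>\<omega>. a * h \<omega> + b * k \<omega>"]) (auto intro!: Lp_space_lincomb less_imp_le[OF p])
  qed
qed

section \<open>Linear spans\<close>

lemma linear_spanE:
  assumes "u \<in> linear_span G"
  obtains n :: nat and c g where "u = (\<lambda>\<omega>. \<Sum>i<n. c i * g i \<omega>)" "\<forall>i<n. g i \<in> G"
  using assms unfolding linear_span_def by (elim CollectE exE conjE) (rule that)

lemma linear_subspace_linear_span: "linear_subspace (linear_span G)"
  unfolding linear_subspace_def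
proof (intro conjI ballI allI)
  show "linear_span G \<noteq> {}"
    by (auto simp: linear_span_def intro!: exI[of _ 0])
  fix u v and a b :: real
  assume "u \<in> linear_span G" "v \<in> linear_span G"
  then obtain n m :: nat and c d g h where u: "u = (\<lambda>\<omega>. \<Sum>i<n. c i * g i \<omega>)" "\<forall>i<n. g i \<in> G"
    and v: "v = (\<lambda>\<omega>. \<Sum>i<m. d i * h i \<omega>)" "\<forall>i<m. h i \<in> G"
    by (elim linear_spanE)
  have split: "(\<Sum>i<n + m. f i) = (\<Sum>i<n. f i) + (\<Sum>i<m. f (n + i))" for f :: "nat \<Rightarrow> real"
    by (induction m) auto
  show "(\<lambda>\<omega>. a * u \<omega> + b * v \<omega>) \<in> linear_span G"
  proof -
    \<comment> \<open>The two finite families are concatenated, the second one shifted by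
      \<open>n\<close>.\<close>
    let ?c = "\<lambda>i. if i < n then a * c i else b * d (i - n)"
    let ?g = "\<lambda>i. if i < n then g i else h (i - n)"
    have "(\<Sum>i<n + m. ?c i * ?g i \<omega>) = a * u \<omega> + b * v \<omega>" for \<omega>
      unfolding split u(1) v(1) sum_distrib_left by (simp add: mult.assoc)
    then have "(\<lambda>\<omega>. a * u \<omega> + b * v \<omega>) = (\<lambda>\<omega>. \<Sum>i<n + m. ?c i * ?g i \<omega>)"
      by presburger
    moreover have "\<forall>i<n + m. ?g i \<in> G"
      using u(2) v(2) by simp
    ultimately show ?thesis
      unfolding linear_span_def by (intro CollectI exI conjI)
  qed
qed

lemma linear_span_subset_Lp_space:
  assumes "0 \<le> p" "G \<subseteq> Lp_space M p"
  shows "linear_span G \<subseteq> Lp_space M p"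
proof
  fix u assume "u \<in> linear_span G"
  then obtain n :: nat and c g where u: "u = (\<lambda>\<omega>. \<Sum>i<n. c i * g i \<omega>)" "\<forall>i<n. g i \<in> G"
    by (elim linear_spanE)
  have "(\<lambda>\<omega>. \<Sum>i<m. c i * g i \<omega>) \<in> Lp_space M p" if "m \<le> n" for m
    using that
  proof (induction m)
    case 0
    then show ?case by (auto intro!: Lp_spaceI)
  next
    case (Suc m)
    then show ?case
      unfolding sum.lessThan_Suc
      using u(2) assms by (intro Lp_space_add Lp_space_cmult) auto
  qed
  then show "u \<in> Lp_space M p" using u by simp
qed

section \<open>Duality and completeness\<close>

text \<open>The assumptions are symmetric in \<open>p\<close> and \<open>q\<close>, so the locale
  can be interpreted again with the exponents exchanged. The minimality in L^q is obtained in this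
  way.\<close>

locale conjugate_exponents = prob_space M for M :: "'a measure" +
  fixes p q :: real
  assumes p: "1 < p" and q: "1 < q" and conjugate: "1 / p + 1 / q = 1"
begin

lemma p_q_mult: "(p - 1) * (q - 1) = 1"
  using p q conjugate by (simp add: field_simps)

lemma Lp_space_imp_integrable:
  assumes r: "1 < r" and u: "u \<in> Lp_space M r"
  shows "integrable M u"
proof (rule Bochner_Integration.integrable_bound)
  show "integrable M (\<lambda>\<omega>. 1 + \<bar>u \<omega>\<bar> powr r)"
    using Lp_spaceD[OF u] by auto
  have "\<bar>x\<bar> \<le> 1 + \<bar>x\<bar> powr r" for x :: real
    using powr_mono[of 1 r "\<bar>x\<bar>"] r by (cases "\<bar>x\<bar> \<le> 1") (auto simp: add_increasing2)
  then show "AE \<omega> in M. norm (u \<omega>) \<le> norm (1 + \<bar>u \<omega>\<bar> powr r)"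
    by (simp add: add_nonneg_nonneg)
qed (use Lp_spaceD[OF u] in auto)

lemma one_in_Lp_space: "(\<lambda>_. 1) \<in> Lp_space M r"
  by (intro Lp_spaceI) auto

lemma integrable_mult_Lq_Lp:
  assumes u: "u \<in> Lp_space M q" and v: "v \<in> Lp_space M p"
  shows "integrable M (\<lambda>\<omega>. u \<omega> * v \<omega>)"
proof (rule Bochner_Integration.integrable_bound)
  show "integrable M (\<lambda>\<omega>. \<bar>u \<omega>\<bar> powr q + \<bar>v \<omega>\<bar> powr p)"
    using Lp_spaceD[OF u] Lp_spaceD[OF v] by auto
  show "AE \<omega> in M. norm (u \<omega> * v \<omega>) \<le> norm (\<bar>u \<omega>\<bar> powr q + \<bar>v \<omega>\<bar> powr p)"
    using abs_mult_le_powr_add_powr[OF p q conjugate] by (simp add: add_nonneg_nonneg)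
qed (use Lp_spaceD[OF u] Lp_spaceD[OF v] in auto)

lemma signed_powr_in_Lq_space:
  assumes u: "u \<in> Lp_space M p"
  shows "(\<lambda>\<omega>. signed_powr (p - 1) (u \<omega>)) \<in> Lp_space M q"
proof (rule Lp_spaceI)
  have "(p - 1) * q = p" using p_q_mult by (simp add: algebra_simps)
  then show "integrable M (\<lambda>\<omega>. \<bar>signed_powr (p - 1) (u \<omega>)\<bar> powr q)"
    using Lp_spaceD[OF u] by (simp add: abs_signed_powr powr_powr)
qed (use Lp_spaceD[OF u] in measurable)

section \<open>Continuity of the pairing between L^q and L^p\<close>

text \<open>Takes the place of Hoelder's inequality. Young's inequality is applied to
  \<open>t * u\<close> and \<open>(1 / t) * w\<close>: a small \<open>t\<close> brings the term with
  \<open>u\<close> to at most \<open>e / 2\<close>, and \<delta> is then what brings the term with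
  \<open>w\<close> below \<open>e / 2\<close>.\<close>

lemma pairing_small:
  assumes u: "u \<in> Lp_space M q" and "0 < e"
  shows "\<exists>\<delta>>0. \<forall>w\<in>Lp_space M p. Lp_moment M p w < \<delta> \<longrightarrow> \<bar>\<integral>\<omega>. u \<omega> * w \<omega> \<partial>M\<bar> < e"
proof -
  define A where "A = Lp_moment M q u + 1"
  have A: "0 < A" by (simp add: A_def add_nonneg_pos)
  define t where "t = (e / (2 * A)) powr (1 / q)"
  have t: "0 < t" using A \<open>0 < e\<close> by (simp add: t_def)
  have tq: "t powr q = e / (2 * A)"
    using q A \<open>0 < e\<close> by (simp add: t_def powr_powr)
  show ?thesis
  proof (intro exI[of _ "e / 2 * t powr p"] conjI ballI impI)
    show "0 < e / 2 * t powr p" using t \<open>0 < e\<close> by simp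
    fix w assume w: "w \<in> Lp_space M p" and small: "Lp_moment M p w < e / 2 * t powr p"
    have "\<bar>\<integral>\<omega>. u \<omega> * w \<omega> \<partial>M\<bar> \<le> (\<integral>\<omega>. \<bar>u \<omega> * w \<omega>\<bar> \<partial>M)"
      by (rule integral_abs_bound)
    also have "\<dots> \<le> (\<integral>\<omega>. t powr q * \<bar>u \<omega>\<bar> powr q + (1 / t) powr p * \<bar>w \<omega>\<bar> powr p \<partial>M)"
    proof (rule integral_mono)
      show "integrable M (\<lambda>\<omega>. \<bar>u \<omega> * w \<omega>\<bar>)"
        using integrable_mult_Lq_Lp[OF u w] by simp
      show "integrable M (\<lambda>\<omega>. t powr q * \<bar>u \<omega>\<bar> powr q + (1 / t) powr p * \<bar>w \<omega>\<bar> powr p)"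
        using Lp_spaceD[OF u] Lp_spaceD[OF w] by simp
      fix \<omega>
      have "\<bar>u \<omega> * w \<omega>\<bar> = \<bar>(t * u \<omega>) * ((1 / t) * w \<omega>)\<bar>" using t by simp
      also have "\<dots> \<le> \<bar>t * u \<omega>\<bar> powr q + \<bar>(1 / t) * w \<omega>\<bar> powr p"
        by (rule abs_mult_le_powr_add_powr[OF p q conjugate])
      also have "\<dots> = t powr q * \<bar>u \<omega>\<bar> powr q + (1 / t) powr p * \<bar>w \<omega>\<bar> powr p"
        using t by (simp only: abs_mult powr_mult) simp
      finally show "\<bar>u \<omega> * w \<omega>\<bar> \<le> t powr q * \<bar>u \<omega>\<bar> powr q + (1 / t) powr p * \<bar>w \<omega>\<bar> powr p" .
    qed
    also have "\<dots> = t powr q * Lp_moment M q u + (1 / t) powr p * Lp_moment M p w"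
      using Lp_spaceD[OF u] Lp_spaceD[OF w] by simp
    also have "\<dots> < e / 2 + e / 2"
    proof (rule add_le_less_mono)
      have "t powr q * Lp_moment M q u \<le> t powr q * A"
        by (intro mult_left_mono) (auto simp: A_def)
      then show "t powr q * Lp_moment M q u \<le> e / 2"
        using A by (simp add: tq)
      have "(1 / t) powr p * Lp_moment M p w < (1 / t) powr p * (e / 2 * t powr p)"
        using small t by (intro mult_strict_left_mono) auto
      also have "\<dots> = e / 2" using t by (simp add: powr_divide)
      finally show "(1 / t) powr p * Lp_moment M p w < e / 2" .
    qed
    finally show "\<bar>\<integral>\<omega>. u \<omega> * w \<omega> \<partial>M\<bar> < e" by simp
  qed
qed

text \<open>For every \<open>h\<close> in \<open>K\<close> of class L^p the pairing of
  \<open>u\<close> with \<open>k\<close> equals that with \<open>k - h\<close>, and the latter can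
  be made arbitrarily small.\<close>

lemma annihilates_Lp_closure:
  assumes u: "u \<in> Lp_space M q" and K: "\<And>h. h \<in> K \<Longrightarrow> (\<integral>\<omega>. u \<omega> * h \<omega> \<partial>M) = 0"
    and k: "k \<in> Lp_closure M p K"
  shows "(\<integral>\<omega>. u \<omega> * k \<omega> \<partial>M) = 0"
proof -
  have p0: "0 < p" using p by simp
  have kL: "k \<in> Lp_space M p" using k Lp_closure_subset_Lp_space by auto
  have "\<bar>\<integral>\<omega>. u \<omega> * k \<omega> \<partial>M\<bar> < e" if e: "0 < e" for e
  proof -
    obtain \<delta> where \<delta>: "0 < \<delta>"
      "\<And>w. w \<in> Lp_space M p \<Longrightarrow> Lp_moment M p w < \<delta> \<Longrightarrow> \<bar>\<integral>\<omega>. u \<omega> * w \<omega> \<partial>M\<bar> < e"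
      using pairing_small[OF u e] by blast
    obtain h where h: "h \<in> K" "h \<in> Lp_space M p" "Lp_moment M p (\<lambda>\<omega>. k \<omega> - h \<omega>) < \<delta>"
      using k \<delta>(1) by (auto simp: Lp_closure_iff[OF p0])
    have "\<bar>\<integral>\<omega>. u \<omega> * (k \<omega> - h \<omega>) \<partial>M\<bar> < e"
      using p by (intro \<delta>(2) Lp_space_diff h kL) auto
    moreover have "(\<integral>\<omega>. u \<omega> * (k \<omega> - h \<omega>) \<partial>M) = (\<integral>\<omega>. u \<omega> * k \<omega> \<partial>M)"
      using integrable_mult_Lq_Lp[OF u] kL h K[of h] by (simp add: right_diff_distrib)
    ultimately show ?thesis by simp
  qed
  from this[of "\<bar>\<integral>\<omega>. u \<omega> * k \<omega> \<partial>M\<bar>"] show ?thesis by auto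
qed

section \<open>Completeness of L^p\<close>

text \<open>Truncation at level \<open>d\<close>: values above it satisfy \<open>\<bar>x\<bar> =
  \<bar>x\<bar> powr (1 - p) * \<bar>x\<bar> powr p\<close>, where the first factor decreases in
  \<open>\<bar>x\<bar>\<close>. It makes a sequence that is Cauchy in L^p also Cauchy in
  L^1.\<close>

lemma expectation_abs_le_Lp_moment:
  assumes d: "0 < d" and u: "u \<in> Lp_space M p"
  shows "(\<integral>\<omega>. \<bar>u \<omega>\<bar> \<partial>M) \<le> d + d powr (1 - p) * Lp_moment M p u"
proof -
  have *: "\<bar>x\<bar> \<le> d + d powr (1 - p) * \<bar>x\<bar> powr p" for x :: real
  proof (cases "\<bar>x\<bar> \<le> d")
    case False
    have "\<bar>x\<bar> = \<bar>x\<bar> powr (1 - p) * \<bar>x\<bar> powr p"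
      using False d by (simp add: powr_add[symmetric])
    also have "\<dots> \<le> d powr (1 - p) * \<bar>x\<bar> powr p"
      using False d p by (intro mult_right_mono powr_mono2') auto
    finally show ?thesis using d by simp
  qed (simp add: add_increasing2)
  have "(\<integral>\<omega>. \<bar>u \<omega>\<bar> \<partial>M) \<le> (\<integral>\<omega>. d + d powr (1 - p) * \<bar>u \<omega>\<bar> powr p \<partial>M)"
    using Lp_space_imp_integrable[OF p u] Lp_spaceD[OF u] by (intro integral_mono *) auto
  also have "\<dots> = d + d powr (1 - p) * Lp_moment M p u"
    using Lp_spaceD[OF u] by (simp add: prob_space)
  finally show ?thesis .
qed

text \<open>A subsequence converges almost everywhere because the sequence is Cauchy in L^1. Fatou's
  lemma along it transfers the Cauchy bound from \<open>u n - u j\<close> to \<open>u n - v\<close>,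
  which gives membership of \<open>v\<close> in L^p and convergence of the whole sequence.\<close>

lemma Lp_complete:
  fixes u :: "nat \<Rightarrow> 'a \<Rightarrow> real"
  assumes u: "\<And>n. u n \<in> Lp_space M p"
    and cauchy: "\<And>e. 0 < e \<Longrightarrow> \<exists>N. \<forall>i\<ge>N. \<forall>j\<ge>N. Lp_moment M p (\<lambda>\<omega>. u i \<omega> - u j \<omega>) < e"
  shows "\<exists>v\<in>Lp_space M p. \<forall>e>0. \<exists>N. \<forall>n\<ge>N. Lp_moment M p (\<lambda>\<omega>. u n \<omega> - v \<omega>) < e"
proof -
  have p0: "0 \<le> p" using p by simp
  note [measurable] = Lp_spaceD(1)[OF u]
  have diff: "(\<lambda>\<omega>. u i \<omega> - u j \<omega>) \<in> Lp_space M p" for i j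
    by (intro Lp_space_diff p0 u)
  have L1: "\<exists>N. \<forall>i\<ge>N. \<forall>j\<ge>N. (\<integral>\<omega>. norm (u i \<omega> - u j \<omega>) \<partial>M) < e" if e: "0 < e" for e
  proof -
    \<comment> \<open>The truncation level takes one half of \<open>e\<close>; a moment below
      \<open>d / d powr (1 - p)\<close> leaves less than the other half.\<close>
    define d where "d = e / 2"
    have d: "0 < d" using e by (simp add: d_def)
    then have "0 < d / d powr (1 - p)" by simp
    then obtain N where N: "\<forall>i\<ge>N. \<forall>j\<ge>N. Lp_moment M p (\<lambda>\<omega>. u i \<omega> - u j \<omega>) < d / d powr (1 - p)"
      using cauchy by blast
    have "(\<integral>\<omega>. norm (u i \<omega> - u j \<omega>) \<partial>M) < e" if "N \<le> i" "N \<le> j" for i j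
    proof -
      have "(\<integral>\<omega>. norm (u i \<omega> - u j \<omega>) \<partial>M)
          \<le> d + d powr (1 - p) * Lp_moment M p (\<lambda>\<omega>. u i \<omega> - u j \<omega>)"
        unfolding real_norm_def by (rule expectation_abs_le_Lp_moment[OF d diff])
      also have "\<dots> < d + d powr (1 - p) * (d / d powr (1 - p))"
        using N that d by (intro add_strict_left_mono mult_strict_left_mono) auto
      also have "\<dots> = e" using d by (simp add: d_def)
      finally show ?thesis .
    qed
    then show ?thesis by blast
  qed
  obtain r where r: "strict_mono r" "AE \<omega> in M. Cauchy (\<lambda>i. u (r i) \<omega>)"
    using cauchy_L1_AE_cauchy_subseq[of M u, OF Lp_space_imp_integrable[OF p u] L1] by blast
  \<comment> \<open>Where the subsequence diverges, on a null set, \<open>lim\<close> is an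
    unspecified value; \<open>v\<close> is measurable nevertheless.\<close>
  define v where "v \<omega> = lim (\<lambda>i. u (r i) \<omega>)" for \<omega>
  have [measurable]: "v \<in> borel_measurable M"
    unfolding v_def by measurable
  have lim: "AE \<omega> in M. (\<lambda>i. u (r i) \<omega>) \<longlonglongrightarrow> v \<omega>"
    using r(2) by eventually_elim (simp add: v_def Cauchy_convergent_iff convergent_LIMSEQ_iff)
  have fatou: "integrable M (\<lambda>\<omega>. \<bar>u n \<omega> - v \<omega>\<bar> powr p) \<and> Lp_moment M p (\<lambda>\<omega>. u n \<omega> - v \<omega>) \<le> e"
    if e: "0 \<le> e" and bound: "\<And>j. N \<le> j \<Longrightarrow> Lp_moment M p (\<lambda>\<omega>. u n \<omega> - u j \<omega>) \<le> e" for n N e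
  proof -
    have "AE \<omega> in M. liminf (\<lambda>i. ennreal (\<bar>u n \<omega> - u (r i) \<omega>\<bar> powr p)) = ennreal (\<bar>u n \<omega> - v \<omega>\<bar> powr p)"
      using lim
    proof eventually_elim
      case (elim \<omega>)
      have "(\<lambda>i. \<bar>u n \<omega> - u (r i) \<omega>\<bar> powr p) \<longlonglongrightarrow> \<bar>u n \<omega> - v \<omega>\<bar> powr p"
        using elim p by (intro tendsto_powr' tendsto_intros) auto
      then show ?case
        by (intro lim_imp_Liminf tendsto_ennrealI) auto
    qed
    then have "(\<integral>\<^sup>+\<omega>. ennreal (\<bar>u n \<omega> - v \<omega>\<bar> powr p) \<partial>M)
        = (\<integral>\<^sup>+\<omega>. liminf (\<lambda>i. ennreal (\<bar>u n \<omega> - u (r i) \<omega>\<bar> powr p)) \<partial>M)"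
      by (intro nn_integral_cong_AE) (auto elim: eventually_mono)
    also have "\<dots> \<le> liminf (\<lambda>i. \<integral>\<^sup>+\<omega>. ennreal (\<bar>u n \<omega> - u (r i) \<omega>\<bar> powr p) \<partial>M)"
      by (rule nn_integral_liminf) measurable
    also have "\<dots> \<le> ennreal e"
    proof (rule Liminf_le)
      show "\<forall>\<^sub>F i in sequentially. (\<integral>\<^sup>+\<omega>. ennreal (\<bar>u n \<omega> - u (r i) \<omega>\<bar> powr p) \<partial>M) \<le> ennreal e"
        using eventually_ge_at_top[of N]
      proof eventually_elim
        case (elim i)
        have "N \<le> r i" using elim seq_suble[OF r(1), of i] by simp
        then show ?case
          using bound Lp_spaceD(2)[OF diff] by (subst nn_integral_eq_integral) (auto intro: ennreal_leI)
      qed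
    qed simp
    finally have le: "(\<integral>\<^sup>+\<omega>. ennreal (\<bar>u n \<omega> - v \<omega>\<bar> powr p) \<partial>M) \<le> ennreal e" .
    have int: "integrable M (\<lambda>\<omega>. \<bar>u n \<omega> - v \<omega>\<bar> powr p)"
      by (rule integrableI_bounded) (use le in \<open>auto intro: le_less_trans\<close>)
    with le e show ?thesis
      by (simp add: nn_integral_eq_integral)
  qed
  show ?thesis
  proof (intro bexI[of _ v] allI impI)
    obtain N where "\<forall>i\<ge>N. \<forall>j\<ge>N. Lp_moment M p (\<lambda>\<omega>. u i \<omega> - u j \<omega>) < 1"
      using cauchy[of 1] by auto
    then have "integrable M (\<lambda>\<omega>. \<bar>u N \<omega> - v \<omega>\<bar> powr p)"
      using fatou[of 1 N N] by (auto intro: less_imp_le)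
    then have "(\<lambda>\<omega>. u N \<omega> - v \<omega>) \<in> Lp_space M p"
      by (intro Lp_spaceI) auto
    from Lp_space_diff[OF p0 u[of N] this] show "v \<in> Lp_space M p" by simp
    fix e :: real assume "0 < e"
    then obtain N where N: "\<forall>i\<ge>N. \<forall>j\<ge>N. Lp_moment M p (\<lambda>\<omega>. u i \<omega> - u j \<omega>) < e / 2"
      using cauchy[of "e / 2"] by auto
    have "Lp_moment M p (\<lambda>\<omega>. u n \<omega> - v \<omega>) \<le> e / 2" if "N \<le> n" for n
      using fatou[of "e / 2" N n] N that \<open>0 < e\<close> by (auto intro: less_imp_le)
    then show "\<exists>N. \<forall>n\<ge>N. Lp_moment M p (\<lambda>\<omega>. u n \<omega> - v \<omega>) < e"
      using \<open>0 < e\<close> by (intro exI[of _ N]) fastforce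
  qed
qed

end

section \<open>Best approximation\<close>

text \<open>Here \<open>d\<close> is the infimum, \<open>a\<close> and \<open>b\<close> are the
  moments of two near-minimizers and \<open>m\<close> is that of their midpoint: the convexity gap
  is at most the excess \<open>t\<close>.\<close>

lemma midpoint_gap:
  fixes a b d m t :: real
  assumes "d \<le> m" "a \<le> d + t" "b \<le> d + t"
  shows "(a + b) / 2 - m \<le> t"
proof -
  have "(a + b) / 2 \<le> d + t" using assms by simp
  then show ?thesis using assms by linarith
qed

context conjugate_exponents
begin

text \<open>The pointwise defect \<open>D\<close> is nonnegative and vanishes only where
  \<open>u\<close> and \<open>v\<close> agree. It is integrable because
  \<open>signed_powr (p - 1)\<close> maps L^p into L^q. The second claim is the source of both
  uniqueness results.\<close>

lemma Lp_moment_tangent: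
  assumes u: "u \<in> Lp_space M p" and v: "v \<in> Lp_space M p"
  shows "Lp_moment M p v + p * (\<integral>\<omega>. signed_powr (p - 1) (v \<omega>) * (u \<omega> - v \<omega>) \<partial>M) \<le> Lp_moment M p u" (is ?le)
    and "Lp_moment M p u \<le> Lp_moment M p v + p * (\<integral>\<omega>. signed_powr (p - 1) (v \<omega>) * (u \<omega> - v \<omega>) \<partial>M)
      \<Longrightarrow> AE \<omega> in M. u \<omega> = v \<omega>"
proof -
  define D where "D \<omega> = \<bar>u \<omega>\<bar> powr p - (\<bar>v \<omega>\<bar> powr p + p * (signed_powr (p - 1) (v \<omega>) * (u \<omega> - v \<omega>)))" for \<omega>
  have int: "integrable M (\<lambda>\<omega>. signed_powr (p - 1) (v \<omega>) * (u \<omega> - v \<omega>))"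
    using p by (intro integrable_mult_Lq_Lp signed_powr_in_Lq_space Lp_space_diff u v) auto
  have D: "integrable M D"
    unfolding D_def using int Lp_spaceD(2)[OF u] Lp_spaceD(2)[OF v] by auto
  have integral: "integral\<^sup>L M D = Lp_moment M p u
      - (Lp_moment M p v + p * (\<integral>\<omega>. signed_powr (p - 1) (v \<omega>) * (u \<omega> - v \<omega>) \<partial>M))"
    unfolding D_def using int Lp_spaceD(2)[OF u] Lp_spaceD(2)[OF v] by simp
  have nonneg: "0 \<le> D \<omega>" for \<omega>
    using abs_powr_ge_tangent[OF p, of "v \<omega>" "u \<omega>"] by (simp add: D_def)
  then have "0 \<le> integral\<^sup>L M D" by simp
  then show ?le using integral by simp
  assume "Lp_moment M p u \<le> Lp_moment M p v + p * (\<integral>\<omega>. signed_powr (p - 1) (v \<omega>) * (u \<omega> - v \<omega>) \<partial>M)"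
  then have "integral\<^sup>L M D = 0"
    using integral \<open>0 \<le> integral\<^sup>L M D\<close> by simp
  then have "AE \<omega> in M. D \<omega> = 0"
    using integral_nonneg_eq_0_iff_AE[OF D] nonneg by simp
  then show "AE \<omega> in M. u \<omega> = v \<omega>"
  proof eventually_elim
    case (elim \<omega>)
    then show ?case
      using abs_powr_greater_tangent[OF p, of "u \<omega>" "v \<omega>"] by (auto simp: D_def)
  qed
qed

lemma Lp_moment_uniformly_convex:
  assumes e: "0 < e"
  shows "\<exists>C\<ge>0. \<forall>u\<in>Lp_space M p. \<forall>v\<in>Lp_space M p.
       Lp_moment M p (\<lambda>\<omega>. u \<omega> - v \<omega>) \<le> e * (Lp_moment M p u + Lp_moment M p v)
         + C * ((Lp_moment M p u + Lp_moment M p v) / 2 - Lp_moment M p (\<lambda>\<omega>. (u \<omega> + v \<omega>) / 2))"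
proof -
  obtain C where C: "0 \<le> C"
    "\<And>x y. \<bar>x - y\<bar> powr p \<le> e * (\<bar>x\<bar> powr p + \<bar>y\<bar> powr p)
       + C * ((\<bar>x\<bar> powr p + \<bar>y\<bar> powr p) / 2 - \<bar>(x + y) / 2\<bar> powr p)"
    using abs_powr_uniformly_convex[OF p e] by metis
  show ?thesis
  proof (intro exI[of _ C] conjI ballI C(1))
    fix u v assume u: "u \<in> Lp_space M p" and v: "v \<in> Lp_space M p"
    have p0: "0 \<le> p" using p by simp
    have mid: "(\<lambda>\<omega>. (u \<omega> + v \<omega>) / 2) \<in> Lp_space M p"
      using Lp_space_lincomb[OF p0 u v, of "1 / 2" "1 / 2"] by (simp add: add_divide_distrib)
    note int = Lp_spaceD(2)[OF u] Lp_spaceD(2)[OF v] Lp_spaceD(2)[OF mid]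
    have "Lp_moment M p (\<lambda>\<omega>. u \<omega> - v \<omega>) \<le> (\<integral>\<omega>. e * (\<bar>u \<omega>\<bar> powr p + \<bar>v \<omega>\<bar> powr p)
        + C * ((\<bar>u \<omega>\<bar> powr p + \<bar>v \<omega>\<bar> powr p) / 2 - \<bar>(u \<omega> + v \<omega>) / 2\<bar> powr p) \<partial>M)"
      using int Lp_spaceD(2)[OF Lp_space_diff[OF p0 u v]]
      by (intro integral_mono C(2) Bochner_Integration.integrable_add
          Bochner_Integration.integrable_diff integrable_mult_right integrable_divide_zero) auto
    also have "\<dots> = e * (Lp_moment M p u + Lp_moment M p v)
         + C * ((Lp_moment M p u + Lp_moment M p v) / 2 - Lp_moment M p (\<lambda>\<omega>. (u \<omega> + v \<omega>) / 2))"
      using int by (simp del: abs_divide)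
    finally show "Lp_moment M p (\<lambda>\<omega>. u \<omega> - v \<omega>) \<le> \<dots>" .
  qed
qed

text \<open>By uniform convexity a minimizing sequence is Cauchy, because midpoints stay in \<open>K\<close>.\<close>

lemma best_approximation_exists:
  assumes K: "linear_subspace K" "Lp_closed M p K" and x: "x \<in> Lp_space M p"
  obtains f where "f \<in> K"
    "\<And>h. h \<in> K \<Longrightarrow> Lp_moment M p (\<lambda>\<omega>. x \<omega> - f \<omega>) \<le> Lp_moment M p (\<lambda>\<omega>. x \<omega> - h \<omega>)"
proof -
  have p0: "0 \<le> p" using p by simp
  have KL: "h \<in> Lp_space M p" if "h \<in> K" for h
    using K(2) that by (auto simp: Lp_closed_def)
  define d where "d = (INF h\<in>K. Lp_moment M p (\<lambda>\<omega>. x \<omega> - h \<omega>))"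
  have bdd: "bdd_below ((\<lambda>h. Lp_moment M p (\<lambda>\<omega>. x \<omega> - h \<omega>)) ` K)"
    by (intro bdd_belowI2[where m = 0]) simp
  have "K \<noteq> {}" using K(1) by (simp add: linear_subspace_def)
  have d_le: "d \<le> Lp_moment M p (\<lambda>\<omega>. x \<omega> - h \<omega>)" if "h \<in> K" for h
    unfolding d_def using bdd that by (rule cINF_lower)
  have d0: "0 \<le> d"
    unfolding d_def using \<open>K \<noteq> {}\<close> by (intro cINF_greatest) auto
  have "\<exists>h. h \<in> K \<and> Lp_moment M p (\<lambda>\<omega>. x \<omega> - h \<omega>) < d + 1 / (real n + 1)" for n
    using \<open>K \<noteq> {}\<close> bdd cINF_less_iff[of K "\<lambda>h. Lp_moment M p (\<lambda>\<omega>. x \<omega> - h \<omega>)" "d + 1 / (real n + 1)"]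
    by (auto simp: d_def[symmetric])
  then have "\<forall>n. \<exists>h. h \<in> K \<and> Lp_moment M p (\<lambda>\<omega>. x \<omega> - h \<omega>) < d + 1 / (real n + 1)"
    by simp
  from choice[OF this] obtain h where h: "\<And>n. h n \<in> K"
    "\<And>n. Lp_moment M p (\<lambda>\<omega>. x \<omega> - h n \<omega>) < d + 1 / (real n + 1)"
    by auto
  have xh: "(\<lambda>\<omega>. x \<omega> - h n \<omega>) \<in> Lp_space M p" for n
    by (intro Lp_space_diff p0 x KL h)
  have cauchy: "\<exists>N. \<forall>i\<ge>N. \<forall>j\<ge>N. Lp_moment M p (\<lambda>\<omega>. h i \<omega> - h j \<omega>) < e" if e: "0 < e" for e
  proof -
    \<comment> \<open>Near-minimizers have moments of at most \<open>d + 1\<close>, so the first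
      term of the convexity estimate is at most \<open>e' * (2 * (d + 1)) = e / 2\<close>.\<close>
    define e' where "e' = e / (4 * (d + 1))"
    have e': "0 < e'" using e d0 by (simp add: e'_def)
    obtain C where C: "0 \<le> C"
      "\<And>u v. u \<in> Lp_space M p \<Longrightarrow> v \<in> Lp_space M p \<Longrightarrow>
         Lp_moment M p (\<lambda>\<omega>. u \<omega> - v \<omega>) \<le> e' * (Lp_moment M p u + Lp_moment M p v)
         + C * ((Lp_moment M p u + Lp_moment M p v) / 2 - Lp_moment M p (\<lambda>\<omega>. (u \<omega> + v \<omega>) / 2))"
      using Lp_moment_uniformly_convex[OF e'] by blast
    obtain N where N: "C * 2 / e < real N"
      using reals_Archimedean2 by blast
    have N': "C * (1 / (real N + 1)) < e / 2"
    proof -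
      have "C * 2 < real N * e" using N e by (simp add: field_simps)
      also have "\<dots> < (real N + 1) * e" using e by simp
      finally show ?thesis by (simp add: field_simps)
    qed
    have "Lp_moment M p (\<lambda>\<omega>. h i \<omega> - h j \<omega>) < e" if ij: "N \<le> i" "N \<le> j" for i j
    proof -
      have small: "Lp_moment M p (\<lambda>\<omega>. x \<omega> - h n \<omega>) \<le> d + 1 / (real N + 1)" if "N \<le> n" for n
      proof -
        have "1 / (real n + 1) \<le> 1 / (real N + 1)"
          using that by (intro divide_left_mono) auto
        then show ?thesis using h(2)[of n] by simp
      qed
      have "1 / (real N + 1) \<le> 1" by simp
      have mid: "(\<lambda>\<omega>. (1 / 2) * h i \<omega> + (1 / 2) * h j \<omega>) \<in> K"
        by (intro linear_subspaceD[OF K(1)] h)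
      have "d \<le> Lp_moment M p (\<lambda>\<omega>. ((x \<omega> - h j \<omega>) + (x \<omega> - h i \<omega>)) / 2)"
      proof -
        have eq: "x \<omega> - ((1 / 2) * h i \<omega> + (1 / 2) * h j \<omega>) = ((x \<omega> - h j \<omega>) + (x \<omega> - h i \<omega>)) / 2" for \<omega>
          by argo
        show ?thesis using d_le[OF mid] unfolding eq .
      qed
      then have gap: "(Lp_moment M p (\<lambda>\<omega>. x \<omega> - h j \<omega>) + Lp_moment M p (\<lambda>\<omega>. x \<omega> - h i \<omega>)) / 2
          - Lp_moment M p (\<lambda>\<omega>. ((x \<omega> - h j \<omega>) + (x \<omega> - h i \<omega>)) / 2) \<le> 1 / (real N + 1)"
        by (rule midpoint_gap[OF _ small[OF ij(2)] small[OF ij(1)]])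
      have "Lp_moment M p (\<lambda>\<omega>. h i \<omega> - h j \<omega>)
          = Lp_moment M p (\<lambda>\<omega>. (x \<omega> - h j \<omega>) - (x \<omega> - h i \<omega>))"
        by simp
      also have "\<dots> \<le> e' * (Lp_moment M p (\<lambda>\<omega>. x \<omega> - h j \<omega>) + Lp_moment M p (\<lambda>\<omega>. x \<omega> - h i \<omega>))
         + C * ((Lp_moment M p (\<lambda>\<omega>. x \<omega> - h j \<omega>) + Lp_moment M p (\<lambda>\<omega>. x \<omega> - h i \<omega>)) / 2
           - Lp_moment M p (\<lambda>\<omega>. ((x \<omega> - h j \<omega>) + (x \<omega> - h i \<omega>)) / 2))"
        by (rule C(2)[OF xh xh])
      also have "\<dots> \<le> e' * ((d + 1) + (d + 1)) + C * (1 / (real N + 1))"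
        using small[OF ij(1)] small[OF ij(2)] \<open>1 / (real N + 1) \<le> 1\<close> e' C(1) gap
        by (intro add_mono mult_left_mono) linarith+
      also have "\<dots> < e' * ((d + 1) + (d + 1)) + e / 2"
        using N' by simp
      also have "\<dots> = e" using d0 by (simp add: e'_def field_simps)
      finally show ?thesis .
    qed
    then show ?thesis by blast
  qed
  obtain f where f: "f \<in> Lp_space M p"
    "\<And>e. 0 < e \<Longrightarrow> \<exists>N. \<forall>n\<ge>N. Lp_moment M p (\<lambda>\<omega>. h n \<omega> - f \<omega>) < e"
    using Lp_complete[of h, OF KL[OF h(1)] cauchy] by blast
  have fK: "f \<in> K"
  proof -
    have "\<exists>k\<in>K. Lp_moment M p (\<lambda>\<omega>. f \<omega> - k \<omega>) < e" if e: "0 < e" for e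
    proof -
      obtain N where "Lp_moment M p (\<lambda>\<omega>. h N \<omega> - f \<omega>) < e"
        using f(2)[OF e] by auto
      then show ?thesis
        using h(1) by (intro bexI[of _ "h N"]) (simp_all add: abs_minus_commute)
    qed
    then show ?thesis using K(2) f(1) by (simp add: Lp_closed_def)
  qed
  have xf: "(\<lambda>\<omega>. x \<omega> - f \<omega>) \<in> Lp_space M p"
    by (intro Lp_space_diff p0 x f)
  \<comment> \<open>Passage to the limit without Minkowski: the tangent inequality at
    \<open>x - f\<close> bounds the moment of \<open>x - f\<close> by that of
    \<open>x - h n\<close>, up to a pairing with \<open>f - h n\<close> that tends to 0.\<close>
  have le_d: "Lp_moment M p (\<lambda>\<omega>. x \<omega> - f \<omega>) \<le> d"
  proof (rule field_le_epsilon)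
    fix e :: real assume e: "0 < e"
    let ?g = "\<lambda>\<omega>. signed_powr (p - 1) (x \<omega> - f \<omega>)"
    have "0 < e / (2 * p)" using e p by simp
    from pairing_small[OF signed_powr_in_Lq_space[OF xf] this]
    obtain \<delta> where \<delta>: "0 < \<delta>" "\<And>w. w \<in> Lp_space M p \<Longrightarrow> Lp_moment M p w < \<delta> \<Longrightarrow>
        \<bar>\<integral>\<omega>. ?g \<omega> * w \<omega> \<partial>M\<bar> < e / (2 * p)"
      by blast
    obtain N where N: "\<forall>n\<ge>N. Lp_moment M p (\<lambda>\<omega>. h n \<omega> - f \<omega>) < \<delta>"
      using f(2)[OF \<delta>(1)] by auto
    obtain m where m: "2 / e < real m" using reals_Archimedean2 by blast
    define n where "n = max N m"
    have "2 / e < real n + 1" using m by (simp add: n_def max_def)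
    then have n1: "1 / (real n + 1) < e / 2" using e by (simp add: field_simps)
    have "\<bar>\<integral>\<omega>. ?g \<omega> * (f \<omega> - h n \<omega>) \<partial>M\<bar> < e / (2 * p)"
      using N by (intro \<delta>(2) Lp_space_diff p0 f KL h) (simp add: n_def abs_minus_commute)
    then have "- (e / (2 * p)) < (\<integral>\<omega>. ?g \<omega> * (f \<omega> - h n \<omega>) \<partial>M)"
      by simp
    then have "p * (- (e / (2 * p))) < p * (\<integral>\<omega>. ?g \<omega> * (f \<omega> - h n \<omega>) \<partial>M)"
      using p by (intro mult_strict_left_mono) auto
    then have "- (e / 2) < p * (\<integral>\<omega>. ?g \<omega> * (f \<omega> - h n \<omega>) \<partial>M)"
      using p by simp
    moreover have "Lp_moment M p (\<lambda>\<omega>. x \<omega> - f \<omega>) + p * (\<integral>\<omega>. ?g \<omega> * (f \<omega> - h n \<omega>) \<partial>M)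
        \<le> Lp_moment M p (\<lambda>\<omega>. x \<omega> - h n \<omega>)"
      using Lp_moment_tangent(1)[OF xh[of n] xf] by simp
    ultimately show "Lp_moment M p (\<lambda>\<omega>. x \<omega> - f \<omega>) \<le> d + e"
      using h(2)[of n] n1 by linarith
  qed
  show ?thesis
    by (rule that[OF fK order_trans[OF le_d d_le]])
qed

text \<open>The tangent inequality at \<open>x - f - t h\<close> bounds \<open>t E[signed_powr (p - 1) (x - f - t h) h]\<close> by \<open>0\<close>;
  then \<open>t\<close> tends to \<open>0\<close> and \<open>h\<close> is replaced by \<open>- h\<close>.\<close>

lemma best_approximation_orthogonal:
  assumes K: "linear_subspace K" "K \<subseteq> Lp_space M p" and x: "x \<in> Lp_space M p"
    and f: "f \<in> K"
      "\<And>h. h \<in> K \<Longrightarrow> Lp_moment M p (\<lambda>\<omega>. x \<omega> - f \<omega>) \<le> Lp_moment M p (\<lambda>\<omega>. x \<omega> - h \<omega>)"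
    and h: "h \<in> K"
  shows "(\<integral>\<omega>. signed_powr (p - 1) (x \<omega> - f \<omega>) * h \<omega> \<partial>M) = 0"
proof -
  have p0: "0 \<le> p" using p by simp
  define a where "a \<omega> = x \<omega> - f \<omega>" for \<omega>
  have a: "a \<in> Lp_space M p"
    unfolding a_def using K(2) f(1) by (intro Lp_space_diff p0 x) auto
  have le: "(\<integral>\<omega>. signed_powr (p - 1) (a \<omega>) * h \<omega> \<partial>M) \<le> 0" if h: "h \<in> K" for h
  proof -
    have hL: "h \<in> Lp_space M p" using K(2) h by auto
    note [measurable] = Lp_spaceD(1)[OF a] Lp_spaceD(1)[OF hL]
    \<comment> \<open>A sequence, to fit dominated convergence; \<open>t n \<le> 1\<close> yields
      the dominating function.\<close>
    define t where "t n = 1 / (real n + 1)" for n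
    have t: "0 < t n" "t n \<le> 1" for n by (simp_all add: t_def)
    define w where "w n \<omega> = a \<omega> - t n * h \<omega>" for n \<omega>
    have w: "w n \<in> Lp_space M p" for n
      unfolding w_def by (intro Lp_space_diff Lp_space_cmult p0 a hL)
    have neg: "(\<integral>\<omega>. signed_powr (p - 1) (w n \<omega>) * h \<omega> \<partial>M) \<le> 0" for n
    proof -
      have "(\<lambda>\<omega>. 1 * f \<omega> + t n * h \<omega>) \<in> K"
        by (intro linear_subspaceD[OF K(1)] f(1) h)
      from f(2)[OF this] have "Lp_moment M p a \<le> Lp_moment M p (w n)"
        by (simp add: a_def w_def algebra_simps)
      then have "p * (\<integral>\<omega>. signed_powr (p - 1) (w n \<omega>) * (a \<omega> - w n \<omega>) \<partial>M) \<le> 0"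
        using Lp_moment_tangent(1)[OF a w[of n]] by simp
      moreover have "(\<integral>\<omega>. signed_powr (p - 1) (w n \<omega>) * (a \<omega> - w n \<omega>) \<partial>M)
          = (\<integral>\<omega>. t n * (signed_powr (p - 1) (w n \<omega>) * h \<omega>) \<partial>M)"
        by (intro Bochner_Integration.integral_cong) (simp_all add: w_def)
      ultimately show ?thesis
        using p t(1)[of n] by (simp add: mult_le_0_iff)
    qed
    have "(\<lambda>n. \<integral>\<omega>. signed_powr (p - 1) (w n \<omega>) * h \<omega> \<partial>M)
        \<longlonglongrightarrow> (\<integral>\<omega>. signed_powr (p - 1) (a \<omega>) * h \<omega> \<partial>M)"
    \<comment> \<open>Both \<open>\<bar>w n \<omega>\<bar>\<close> and
      \<open>\<bar>h \<omega>\<bar>\<close> are at most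
      \<open>\<bar>a \<omega>\<bar> + \<bar>h \<omega>\<bar>\<close>, so the product is bounded by
      the \<open>p\<close>-th power of that sum. The outer absolute value only matches the form of
      \<open>Lp_space\<close>.\<close>
    proof (rule integral_dominated_convergence[where w = "\<lambda>\<omega>. \<bar>\<bar>a \<omega>\<bar> + \<bar>h \<omega>\<bar>\<bar> powr p"])
      have "(\<lambda>\<omega>. \<bar>a \<omega>\<bar>) \<in> Lp_space M p" "(\<lambda>\<omega>. \<bar>h \<omega>\<bar>) \<in> Lp_space M p"
        using Lp_spaceD[OF a] Lp_spaceD[OF hL] by (auto intro!: Lp_spaceI)
      then show "integrable M (\<lambda>\<omega>. \<bar>\<bar>a \<omega>\<bar> + \<bar>h \<omega>\<bar>\<bar> powr p)"
        by (intro Lp_spaceD(2) Lp_space_add p0)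
      have "(\<lambda>n. signed_powr (p - 1) (w n \<omega>) * h \<omega>)
          \<longlonglongrightarrow> signed_powr (p - 1) (a \<omega>) * h \<omega>" for \<omega>
      proof (intro tendsto_intros isCont_tendsto_compose[OF continuous_signed_powr])
        have "t \<longlonglongrightarrow> 0"
          unfolding t_def using LIMSEQ_inverse_real_of_nat by (simp add: inverse_eq_divide add.commute)
        then have "(\<lambda>n. a \<omega> - t n * h \<omega>) \<longlonglongrightarrow> a \<omega> - 0 * h \<omega>"
          by (intro tendsto_intros)
        then show "(\<lambda>n. w n \<omega>) \<longlonglongrightarrow> a \<omega>"
          by (simp add: w_def)
      qed (use p in simp)
      then show "AE \<omega> in M. (\<lambda>n. signed_powr (p - 1) (w n \<omega>) * h \<omega>)
          \<longlonglongrightarrow> signed_powr (p - 1) (a \<omega>) * h \<omega>"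
        by simp
      have "norm (signed_powr (p - 1) (w n \<omega>) * h \<omega>) \<le> \<bar>\<bar>a \<omega>\<bar> + \<bar>h \<omega>\<bar>\<bar> powr p" for n \<omega>
      proof -
        define z where "z = \<bar>a \<omega>\<bar> + \<bar>h \<omega>\<bar>"
        have "\<bar>t n * h \<omega>\<bar> \<le> \<bar>h \<omega>\<bar>"
          using t[of n] by (simp add: abs_mult mult_left_le_one_le)
        then have "\<bar>w n \<omega>\<bar> \<le> z"
          unfolding w_def z_def by linarith
        then have "\<bar>w n \<omega>\<bar> powr (p - 1) * \<bar>h \<omega>\<bar> \<le> z powr (p - 1) * z"
          using p by (intro mult_mono powr_mono2) (auto simp: z_def)
        also have "\<dots> = z powr p"
          using powr_mult_base[of z "p - 1"] by (simp add: z_def mult.commute)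
        finally show ?thesis
          by (simp add: abs_mult abs_signed_powr z_def)
      qed
      then show "AE \<omega> in M. norm (signed_powr (p - 1) (w n \<omega>) * h \<omega>) \<le> \<bar>\<bar>a \<omega>\<bar> + \<bar>h \<omega>\<bar>\<bar> powr p" for n
        by simp
    qed (simp_all add: w_def)
    then show ?thesis
      by (rule LIMSEQ_le_const2) (use neg in auto)
  qed
  have "(\<lambda>\<omega>. (- 1) * h \<omega> + 0 * h \<omega>) \<in> K"
    by (intro linear_subspaceD[OF K(1)] h)
  from le[OF this] le[OF h] show ?thesis
    by (simp add: a_def)
qed

text \<open>As \<open>f - f'\<close> lies in \<open>K\<close>, orthogonality removes the linear term
  of the tangent inequality at \<open>x - f\<close>; its equality case then applies to
  \<open>x - f'\<close>.\<close>

lemma best_approximation_unique: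
  assumes K: "linear_subspace K" "K \<subseteq> Lp_space M p" and x: "x \<in> Lp_space M p"
    and f: "f \<in> K"
      "\<And>h. h \<in> K \<Longrightarrow> Lp_moment M p (\<lambda>\<omega>. x \<omega> - f \<omega>) \<le> Lp_moment M p (\<lambda>\<omega>. x \<omega> - h \<omega>)"
    and f': "f' \<in> K" "Lp_moment M p (\<lambda>\<omega>. x \<omega> - f' \<omega>) \<le> Lp_moment M p (\<lambda>\<omega>. x \<omega> - f \<omega>)"
  shows "AE \<omega> in M. f \<omega> = f' \<omega>"
proof -
  have p0: "0 \<le> p" using p by simp
  have xf: "(\<lambda>\<omega>. x \<omega> - f \<omega>) \<in> Lp_space M p" "(\<lambda>\<omega>. x \<omega> - f' \<omega>) \<in> Lp_space M p"
    using K(2) f(1) f'(1) by (auto intro!: Lp_space_diff p0 x)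
  have "(\<lambda>\<omega>. 1 * f \<omega> + (- 1) * f' \<omega>) \<in> K"
    by (intro linear_subspaceD[OF K(1)] f(1) f'(1))
  from best_approximation_orthogonal[OF K x f this]
  have "(\<integral>\<omega>. signed_powr (p - 1) (x \<omega> - f \<omega>) * ((x \<omega> - f' \<omega>) - (x \<omega> - f \<omega>)) \<partial>M) = 0"
    by simp
  then have "AE \<omega> in M. x \<omega> - f' \<omega> = x \<omega> - f \<omega>"
    using f'(2) by (intro Lp_moment_tangent(2) xf) simp
  then show ?thesis by eventually_elim simp
qed

end

section \<open>Simple integrals\<close>

text \<open>The random time is approximated strictly from the right by times with countably many values.\<close>

lemma cadlag_process_at_random_time_measurable:
  fixes X :: "real \<Rightarrow> 'a \<Rightarrow> real ^ 'd"
  assumes X: "\<And>t. 0 \<le> t \<Longrightarrow> X t \<in> borel_measurable M"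
    and cadlag: "cadlag_process M X"
    and T: "T \<in> borel_measurable M" "\<And>\<omega>. \<omega> \<in> space M \<Longrightarrow> 0 \<le> T \<omega>"
  shows "(\<lambda>\<omega>. X (T \<omega>) \<omega>) \<in> borel_measurable M"
proof (rule borel_measurable_LIMSEQ_metric)
  \<comment> \<open>\<open>A n\<close> is the first point of the grid of mesh
    \<open>1 / (n + 1)\<close> strictly beyond \<open>T\<close>. The summand 1 matters when
    \<open>T\<close> lies on the grid, since the limit along \<open>at_right\<close> excludes the
    point itself.\<close>
  define k where "k n \<omega> = nat \<lfloor>(real n + 1) * T \<omega>\<rfloor> + 1" for n \<omega>
  define A where "A n \<omega> = real (k n \<omega>) / (real n + 1)" for n \<omega>
  show "(\<lambda>\<omega>. X (A n \<omega>) \<omega>) \<in> borel_measurable M" for n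
  proof -
    have "k n \<in> measurable M (count_space UNIV)"
      unfolding k_def using T(1) by measurable
    then show ?thesis
      unfolding A_def
      by (rule measurable_compose_countable[rotated, where f = "\<lambda>i. X (real i / (real n + 1))"])
        (intro X, simp)
  qed
  fix \<omega> assume \<omega>: "\<omega> \<in> space M"
  have bounds: "T \<omega> < A n \<omega>" "A n \<omega> \<le> T \<omega> + 1 / (real n + 1)" for n
  proof -
    have "0 \<le> (real n + 1) * T \<omega>" using T(2)[OF \<omega>] by simp
    then have "real (k n \<omega>) = of_int \<lfloor>(real n + 1) * T \<omega>\<rfloor> + 1"
      by (simp add: k_def)
    then have "(real n + 1) * T \<omega> < real (k n \<omega>)" "real (k n \<omega>) \<le> (real n + 1) * T \<omega> + 1"
      by linarith+
    moreover have "T \<omega> + 1 / (real n + 1) = ((real n + 1) * T \<omega> + 1) / (real n + 1)"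
      by (simp add: add_divide_distrib)
    ultimately show "T \<omega> < A n \<omega>" "A n \<omega> \<le> T \<omega> + 1 / (real n + 1)"
      by (simp_all add: A_def pos_less_divide_eq divide_right_mono mult.commute)
  qed
  have "(\<lambda>n. 1 / (real n + 1)) \<longlonglongrightarrow> 0"
    using LIMSEQ_inverse_real_of_nat by (simp add: inverse_eq_divide add.commute)
  from tendsto_add[OF tendsto_const this]
  have "(\<lambda>n. T \<omega> + 1 / (real n + 1)) \<longlonglongrightarrow> T \<omega>"
    by simp
  from tendsto_sandwich[OF _ _ tendsto_const this] have "(\<lambda>n. A n \<omega>) \<longlonglongrightarrow> T \<omega>"
    using bounds by (simp add: less_imp_le)
  then have "filterlim (\<lambda>n. A n \<omega>) (at_right (T \<omega>)) sequentially"
    using bounds(1) by (intro tendsto_imp_filterlim_at_right) auto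
  moreover have "((\<lambda>t. X t \<omega>) \<longlongrightarrow> X (T \<omega>) \<omega>) (at_right (T \<omega>))"
    using cadlag \<omega> T(2)[OF \<omega>] by (simp add: cadlag_process_def cadlag_def)
  ultimately show "(\<lambda>n. X (A n \<omega>) \<omega>) \<longlonglongrightarrow> X (T \<omega>) \<omega>"
    by (rule filterlim_compose[rotated])
qed

context filtered_prob_space
begin

lemma finite_stopping_time_measurable:
  assumes "finite_stopping_time M F \<tau>"
  shows "\<tau> \<in> borel_measurable M"
proof (rule measurable_stopping_time)
  show "stopping_time F \<tau>" using assms by (simp add: finite_stopping_time_def)
qed (use subalgebra_F in \<open>simp_all add: subalgebra_def\<close>)

text \<open>Finiteness of \<tau> enters here: \<open>A\<close> is exhausted by its intersections
  with \<open>\<tau> \<le> n\<close>, each of which belongs to \<open>F n\<close>.\<close>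

lemma subalgebra_pre_sigma:
  assumes \<tau>: "finite_stopping_time M F \<tau>"
  shows "subalgebra M (pre_sigma \<tau>)"
  unfolding subalgebra_def
proof (intro conjI subsetI)
  show "space (pre_sigma \<tau>) = space M" by (rule space_pre_sigma)
  fix A assume A: "A \<in> sets (pre_sigma \<tau>)"
  have st: "stopping_time F \<tau>" using \<tau> by (simp add: finite_stopping_time_def)
  have "{\<omega> \<in> A. \<tau> \<omega> \<le> real n} \<in> sets M" for n
    using sets_pre_sigmaD[OF st A, of "real n"] subalgebra_F[of "real n"]
    by (auto simp: subalgebra_def)
  then have "(\<Union>n. {\<omega> \<in> A. \<tau> \<omega> \<le> real n}) \<in> sets M"
    by blast
  also have "(\<Union>n. {\<omega> \<in> A. \<tau> \<omega> \<le> real n}) = A"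
    by (auto intro: real_arch_simple)
  finally show "A \<in> sets M" .
qed

lemma semimartingale_measurable:
  fixes S :: "real \<Rightarrow> 'a \<Rightarrow> real ^ 'd"
  assumes S: "semimartingale M F S" and t: "0 \<le> t"
  shows "S t \<in> borel_measurable M"
proof -
  have "(\<lambda>\<omega>. S t \<omega> $ i) \<in> borel_measurable (F t)" for i
    using S t by (simp add: semimartingale_def real_semimartingale_def adapted_process_def)
  then have "(\<lambda>\<omega>. S t \<omega> $ i) \<in> borel_measurable M" for i
    by (rule measurable_from_subalg[OF subalgebra_F[of t]])
  then show ?thesis
    by (subst borel_measurable_euclidean_space) (auto simp: Basis_vec_def inner_axis)
qed

text \<open>Since \<open>\<tau>1 \<le> \<tau>2\<close> almost surely, \<open>S\<close> at either
  time is a value of the process stopped at \<open>\<tau>2\<close>. One constant \<open>C\<close>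
  thus bounds both, and the increment is at most \<open>C + C\<close>.\<close>

lemma simple_integrals_subset_Lp_space:
  fixes S :: "real \<Rightarrow> 'a \<Rightarrow> real ^ 'd"
  assumes S: "semimartingale M F S" "cadlag_process M S" and p: "0 \<le> p"
  shows "simple_integrals M F S \<subseteq> Lp_space M p"
proof
  fix u assume "u \<in> simple_integrals M F S"
  then obtain \<phi> \<tau>1 \<tau>2 where u: "u = (\<lambda>\<omega>. \<phi> \<omega> \<bullet> (S (\<tau>2 \<omega>) \<omega> - S (\<tau>1 \<omega>) \<omega>))"
    and \<tau>1: "finite_stopping_time M F \<tau>1" and \<tau>2: "finite_stopping_time M F \<tau>2"
    and le: "AE \<omega> in M. \<tau>1 \<omega> \<le> \<tau>2 \<omega>"
    and bounded: "bounded_process M (stopped_process S \<tau>2)"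
    and \<phi>: "\<phi> \<in> borel_measurable (pre_sigma \<tau>1)" "bounded (\<phi> ` space M)"
    unfolding simple_integrals_def by auto
  have nonneg: "0 \<le> \<tau>1 \<omega>" "0 \<le> \<tau>2 \<omega>" if "\<omega> \<in> space M" for \<omega>
    using \<tau>1 \<tau>2 that by (auto simp: finite_stopping_time_def)
  have "(\<lambda>\<omega>. S (\<tau> \<omega>) \<omega>) \<in> borel_measurable M" if \<tau>: "finite_stopping_time M F \<tau>" for \<tau>
  proof (rule cadlag_process_at_random_time_measurable[OF _ S(2) finite_stopping_time_measurable[OF \<tau>]])
    show "S t \<in> borel_measurable M" if "0 \<le> t" for t
      by (rule semimartingale_measurable[OF S(1) that])
    show "0 \<le> \<tau> \<omega>" if "\<omega> \<in> space M" for \<omega>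
      using \<tau> that by (simp add: finite_stopping_time_def)
  qed
  note [measurable] = this[OF \<tau>1] this[OF \<tau>2]
  have [measurable]: "\<phi> \<in> borel_measurable M"
    by (rule measurable_from_subalg[OF subalgebra_pre_sigma[OF \<tau>1] \<phi>(1)])
  obtain B where B: "\<And>\<omega>. \<omega> \<in> space M \<Longrightarrow> norm (\<phi> \<omega>) \<le> B"
    using \<phi>(2) by (auto simp: bounded_iff)
  obtain C where C: "AE \<omega> in M. \<forall>t\<ge>0. norm (S (min (\<tau>2 \<omega>) t) \<omega>) \<le> C"
    using bounded by (auto simp: bounded_process_def stopped_process_def)
  show "u \<in> Lp_space M p"
  proof (rule Lp_space_bounded[OF p])
    show "u \<in> borel_measurable M" unfolding u by measurable
    show "AE \<omega> in M. \<bar>u \<omega>\<bar> \<le> B * (C + C)"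
      using le C AE_space
    proof eventually_elim
      case (elim \<omega>)
      have "norm (S (\<tau>2 \<omega>) \<omega>) \<le> C" "norm (S (\<tau>1 \<omega>) \<omega>) \<le> C"
        using elim(1) nonneg[OF elim(3)] elim(2)[rule_format, of "\<tau>2 \<omega>"]
          elim(2)[rule_format, of "\<tau>1 \<omega>"] by (simp_all add: min_def split: if_splits)
      then have "norm (S (\<tau>2 \<omega>) \<omega> - S (\<tau>1 \<omega>) \<omega>) \<le> C + C"
        by (intro order_trans[OF norm_triangle_ineq4] add_mono)
      then have "norm (\<phi> \<omega>) * norm (S (\<tau>2 \<omega>) \<omega> - S (\<tau>1 \<omega>) \<omega>) \<le> B * (C + C)"
        using B[OF elim(3)] norm_ge_zero[of "\<phi> \<omega>"] by (intro mult_mono norm_ge_zero) linarith+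
      then show ?case
        unfolding u by (rule order_trans[OF Cauchy_Schwarz_ineq2])
    qed
  qed
qed

lemma K0_subset_Lp_space:
  fixes S :: "real \<Rightarrow> 'a \<Rightarrow> real ^ 'd"
  assumes "semimartingale M F S" "cadlag_process M S" "0 \<le> p"
  shows "K0 M F S \<subseteq> Lp_space M p"
  unfolding K0_def using assms
  by (intro linear_span_subset_Lp_space simple_integrals_subset_Lp_space)

end

section \<open>Measures of minimal norm\<close>

lemma closest_to_one_iff:
  assumes p: "0 < p"
  shows "closest_to_one M p K f \<longleftrightarrow>
    f \<in> K \<and> (\<forall>h\<in>K. Lp_moment M p (\<lambda>\<omega>. 1 - f \<omega>) \<le> Lp_moment M p (\<lambda>\<omega>. 1 - h \<omega>))"
proof -
  have bdd: "bdd_below ((\<lambda>h. Lp_norm M p (\<lambda>\<omega>. 1 - h \<omega>)) ` K)"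
    by (rule bdd_belowI2[where m = 0]) (rule Lp_norm_nonneg)
  have "Lp_norm M p (\<lambda>\<omega>. 1 - f \<omega>) = (INF h\<in>K. Lp_norm M p (\<lambda>\<omega>. 1 - h \<omega>)) \<longleftrightarrow>
      (\<forall>h\<in>K. Lp_norm M p (\<lambda>\<omega>. 1 - f \<omega>) \<le> Lp_norm M p (\<lambda>\<omega>. 1 - h \<omega>))" if f: "f \<in> K"
  proof
    assume "Lp_norm M p (\<lambda>\<omega>. 1 - f \<omega>) = (INF h\<in>K. Lp_norm M p (\<lambda>\<omega>. 1 - h \<omega>))"
    then show "\<forall>h\<in>K. Lp_norm M p (\<lambda>\<omega>. 1 - f \<omega>) \<le> Lp_norm M p (\<lambda>\<omega>. 1 - h \<omega>)"
      using cINF_lower[OF bdd] by simp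
  next
    assume "\<forall>h\<in>K. Lp_norm M p (\<lambda>\<omega>. 1 - f \<omega>) \<le> Lp_norm M p (\<lambda>\<omega>. 1 - h \<omega>)"
    then have "Lp_norm M p (\<lambda>\<omega>. 1 - f \<omega>) \<le> (INF h\<in>K. Lp_norm M p (\<lambda>\<omega>. 1 - h \<omega>))"
      using f by (intro cINF_greatest) auto
    then show "Lp_norm M p (\<lambda>\<omega>. 1 - f \<omega>) = (INF h\<in>K. Lp_norm M p (\<lambda>\<omega>. 1 - h \<omega>))"
      using cINF_lower[OF bdd f] by (rule antisym)
  qed
  then show ?thesis
    using p by (auto simp: closest_to_one_def Lp_norm_le_iff)
qed

lemma g_star_eq: "g_star p f \<omega> = signed_powr (p - 1) (1 - f \<omega>)"
  by (simp add: g_star_def signed_powr_def)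

context conjugate_exponents
begin

text \<open>Both sets over which the norm is minimized will turn out to be of this form, so
  minimality is proved once, for an abstract closed subspace.\<close>

definition normalized_annihilator :: "('a \<Rightarrow> real) set \<Rightarrow> ('a \<Rightarrow> real) set" where
  "normalized_annihilator K = {v \<in> Lq_annihilator M q K. (\<integral>\<omega>. v \<omega> \<partial>M) = 1}"

lemma one_notin_if_normalized_annihilator:
  assumes "u \<in> normalized_annihilator K"
  shows "(\<lambda>_. 1) \<notin> K"
  using assms by (fastforce simp: normalized_annihilator_def Lq_annihilator_def)

lemma closest_to_one_exists:
  assumes "linear_subspace K" "Lp_closed M p K"
  shows "\<exists>f. closest_to_one M p K f"
proof -
  have "\<exists>f\<in>K. \<forall>h\<in>K. Lp_moment M p (\<lambda>\<omega>. 1 - f \<omega>) \<le> Lp_moment M p (\<lambda>\<omega>. 1 - h \<omega>)"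
    by (rule best_approximation_exists[OF assms one_in_Lp_space]) blast
  then show ?thesis
    using p by (auto simp: closest_to_one_iff)
qed

lemma closest_to_one_unique:
  assumes K: "linear_subspace K" "Lp_closed M p K"
    and "closest_to_one M p K f" "closest_to_one M p K f'"
  shows "AE \<omega> in M. f \<omega> = f' \<omega>"
  using assms p
  by (intro best_approximation_unique[OF K(1) _ one_in_Lp_space])
    (auto simp: closest_to_one_iff Lp_closed_def)

lemma g_star_annihilates:
  assumes K: "linear_subspace K" "Lp_closed M p K" and f: "closest_to_one M p K f"
  shows "g_star p f \<in> Lq_annihilator M q K"
proof -
  have p0: "0 < p" using p by simp
  have f': "f \<in> K" "\<And>h. h \<in> K \<Longrightarrow> Lp_moment M p (\<lambda>\<omega>. 1 - f \<omega>) \<le> Lp_moment M p (\<lambda>\<omega>. 1 - h \<omega>)"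
    using f by (auto simp: closest_to_one_iff[OF p0])
  have KL: "K \<subseteq> Lp_space M p" using K(2) by (simp add: Lp_closed_def)
  have "(\<lambda>\<omega>. 1 - f \<omega>) \<in> Lp_space M p"
    using p0 f'(1) KL by (intro Lp_space_diff one_in_Lp_space) auto
  from signed_powr_in_Lq_space[OF this]
  have "g_star p f \<in> Lp_space M q"
    by (simp add: g_star_eq[abs_def])
  then show ?thesis
    using best_approximation_orthogonal[OF K(1) KL one_in_Lp_space f']
    by (simp add: Lq_annihilator_def g_star_eq)
qed

lemma integral_g_star_pos:
  assumes K: "linear_subspace K" "Lp_closed M p K" and f: "closest_to_one M p K f"
    and one: "(\<lambda>_. 1) \<notin> K"
  shows "0 < (\<integral>\<omega>. g_star p f \<omega> \<partial>M)"
proof -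
  have p0: "0 < p" using p by simp
  have fK: "f \<in> K" using f by (simp add: closest_to_one_def)
  have fL: "f \<in> Lp_space M p" using K(2) fK by (auto simp: Lp_closed_def)
  have ann: "g_star p f \<in> Lp_space M q" "(\<integral>\<omega>. g_star p f \<omega> * f \<omega> \<partial>M) = 0"
    using g_star_annihilates[OF K f] fK by (auto simp: Lq_annihilator_def)
  have "Lp_moment M p (\<lambda>\<omega>. 1 - f \<omega>) = (\<integral>\<omega>. g_star p f \<omega> * (1 - f \<omega>) \<partial>M)"
    by (simp add: g_star_eq signed_powr_mult_self)
  also have "\<dots> = (\<integral>\<omega>. g_star p f \<omega> - g_star p f \<omega> * f \<omega> \<partial>M)"
    by (simp add: right_diff_distrib)
  also have "\<dots> = (\<integral>\<omega>. g_star p f \<omega> \<partial>M)"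
    using ann Lp_space_imp_integrable[OF q ann(1)] integrable_mult_Lq_Lp[OF ann(1) fL] by simp
  finally have eq: "Lp_moment M p (\<lambda>\<omega>. 1 - f \<omega>) = (\<integral>\<omega>. g_star p f \<omega> \<partial>M)" .
  have "Lp_moment M p (\<lambda>\<omega>. 1 - f \<omega>) \<noteq> 0"
  proof
    assume "Lp_moment M p (\<lambda>\<omega>. 1 - f \<omega>) = 0"
    \<comment> \<open>A vanishing moment gives \<open>f = 1\<close> only almost everywhere;
      closedness turns this into membership of the constant function itself.\<close>
    then have "\<forall>e>0. \<exists>h\<in>K. Lp_moment M p (\<lambda>\<omega>. 1 - h \<omega>) < e"
      using fK by (intro allI impI bexI[of _ f]) simp_all
    then have "(\<lambda>_. 1) \<in> K"
      using K(2) one_in_Lp_space by (simp add: Lp_closed_def)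
    with one show False by simp
  qed
  moreover have "0 \<le> Lp_moment M p (\<lambda>\<omega>. 1 - f \<omega>)" by simp
  ultimately show ?thesis using eq by linarith
qed

text \<open>The dual of the normalized \<open>g\<^sup>*\<close> is a multiple of \<open>1 - f\<close>, whose pairing with every competitor is
  \<open>1\<close>; hence the linear term of the tangent inequality in \<open>L\<^sup>q\<close> vanishes.\<close>

lemma normalized_g_star_minimal:
  assumes K: "linear_subspace K" "Lp_closed M p K" and f: "closest_to_one M p K f"
    and one: "(\<lambda>_. 1) \<notin> K"
  shows "unique_min_Lp_norm M q (normalized_annihilator K)
    (\<lambda>\<omega>. g_star p f \<omega> / (\<integral>\<omega>'. g_star p f \<omega>' \<partial>M))"
proof -
  interpret dual: conjugate_exponents M q p
    by unfold_locales (use p q conjugate in auto)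
  have q0: "0 < q" using q by simp
  have p0: "0 \<le> p" using p by simp
  define c where "c = (\<integral>\<omega>. g_star p f \<omega> \<partial>M)"
  have c: "0 < c" unfolding c_def by (rule integral_g_star_pos[OF assms])
  define u where "u \<omega> = g_star p f \<omega> / c" for \<omega>
  have fK: "f \<in> K" using f by (simp add: closest_to_one_def)
  have fL: "f \<in> Lp_space M p" using K(2) fK by (auto simp: Lp_closed_def)
  have g: "g_star p f \<in> Lp_space M q" "\<And>h. h \<in> K \<Longrightarrow> (\<integral>\<omega>. g_star p f \<omega> * h \<omega> \<partial>M) = 0"
    using g_star_annihilates[OF K f] by (auto simp: Lq_annihilator_def)
  have uL: "u \<in> Lp_space M q"
    using Lp_space_cmult[OF g(1), of "1 / c"] by (simp add: u_def[abs_def])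
  have u: "u \<in> normalized_annihilator K"
    using uL g(2) c by (simp add: normalized_annihilator_def Lq_annihilator_def u_def[abs_def] c_def)
  have pair: "integrable M (\<lambda>\<omega>. v \<omega> * (1 - f \<omega>))" "(\<integral>\<omega>. v \<omega> * (1 - f \<omega>) \<partial>M) = 1"
    if v: "v \<in> normalized_annihilator K" for v
  proof -
    have v': "v \<in> Lp_space M q" "(\<integral>\<omega>. v \<omega> * f \<omega> \<partial>M) = 0" "(\<integral>\<omega>. v \<omega> \<partial>M) = 1"
      using v fK by (auto simp: normalized_annihilator_def Lq_annihilator_def)
    show "integrable M (\<lambda>\<omega>. v \<omega> * (1 - f \<omega>))"
      by (intro integrable_mult_Lq_Lp v' Lp_space_diff one_in_Lp_space fL p0)
    have "(\<integral>\<omega>. v \<omega> * (1 - f \<omega>) \<partial>M) = (\<integral>\<omega>. v \<omega> - v \<omega> * f \<omega> \<partial>M)"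
      by (simp add: right_diff_distrib)
    also have "\<dots> = 1"
      using v' Lp_space_imp_integrable[OF q v'(1)] integrable_mult_Lq_Lp[OF v'(1) fL] by simp
    finally show "(\<integral>\<omega>. v \<omega> * (1 - f \<omega>) \<partial>M) = 1" .
  qed
  \<comment> \<open>This is \<open>c powr (1 - q)\<close>, a constant that comes out of the
    integral.\<close>
  define k where "k = signed_powr (q - 1) (1 / c)"
  have dual_u: "signed_powr (q - 1) (u \<omega>) = k * (1 - f \<omega>)" for \<omega>
  proof -
    have "signed_powr (q - 1) (u \<omega>)
        = signed_powr (q - 1) (1 / c) * signed_powr (q - 1) (signed_powr (p - 1) (1 - f \<omega>))"
      unfolding signed_powr_mult[symmetric] by (simp add: u_def g_star_eq)
    then show ?thesis
      using p_q_mult by (simp add: k_def signed_powr_signed_powr mult.commute)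
  qed
  have tangent: "(\<integral>\<omega>. signed_powr (q - 1) (u \<omega>) * (v \<omega> - u \<omega>) \<partial>M) = 0"
    if v: "v \<in> normalized_annihilator K" for v
  proof -
    have "(\<integral>\<omega>. signed_powr (q - 1) (u \<omega>) * (v \<omega> - u \<omega>) \<partial>M)
        = (\<integral>\<omega>. k * (v \<omega> * (1 - f \<omega>) - u \<omega> * (1 - f \<omega>)) \<partial>M)"
      unfolding dual_u by (intro Bochner_Integration.integral_cong) (simp_all add: algebra_simps)
    also have "\<dots> = k * ((\<integral>\<omega>. v \<omega> * (1 - f \<omega>) \<partial>M) - (\<integral>\<omega>. u \<omega> * (1 - f \<omega>) \<partial>M))"
      using pair(1)[OF u] pair(1)[OF v] by simp
    also have "\<dots> = 0" using pair(2)[OF u] pair(2)[OF v] by simp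
    finally show ?thesis .
  qed
  have vL: "v \<in> Lp_space M q" if "v \<in> normalized_annihilator K" for v
    using that by (simp add: normalized_annihilator_def Lq_annihilator_def)
  have "unique_min_Lp_norm M q (normalized_annihilator K) u"
    unfolding unique_min_Lp_norm_def
  proof (intro conjI ballI impI u)
    fix v assume v: "v \<in> normalized_annihilator K"
    show "Lp_norm M q u \<le> Lp_norm M q v"
      using dual.Lp_moment_tangent(1)[OF vL[OF v] uL] tangent[OF v]
      by (simp add: Lp_norm_le_iff[OF q0])
    assume "Lp_norm M q v = Lp_norm M q u"
    then have "Lp_moment M q v \<le> Lp_moment M q u"
      by (simp add: Lp_norm_le_iff[OF q0, symmetric])
    then show "AE \<omega> in M. v \<omega> = u \<omega>"
      using dual.Lp_moment_tangent(2)[OF vL[OF v] uL] tangent[OF v] by simp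
  qed
  then show ?thesis by (simp add: u_def[abs_def] c_def)
qed

text \<open>If 1 is outside \<open>K\<close>, the normalized \<open>g_star\<close> of a best
  approximation is an explicit member. Conversely, a member pairs with 1 to give its expectation 1,
  so 1 cannot lie in \<open>K\<close>.\<close>

lemma normalized_annihilator_nonempty_iff:
  assumes K: "linear_subspace K" "Lp_closed M p K"
  shows "normalized_annihilator K \<noteq> {} \<longleftrightarrow> (\<lambda>_. 1) \<notin> K"
proof
  assume "(\<lambda>_. 1) \<notin> K"
  moreover obtain f where "closest_to_one M p K f"
    using closest_to_one_exists[OF K] by blast
  ultimately show "normalized_annihilator K \<noteq> {}"
    using normalized_g_star_minimal[OF K] by (auto simp: unique_min_Lp_norm_def)
qed (use one_notin_if_normalized_annihilator in blast)

end

theorem theorem2p4: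
  fixes M :: "'a measure" and F :: "real \<Rightarrow> 'a measure"
    and S :: "real \<Rightarrow> 'a \<Rightarrow> real ^ 'd" and p q :: real
  assumes "filtered_prob_space M F"
    and "semimartingale M F S"
    and "cadlag_process M S"
    and "locally_bounded_process M F S"
    and "q > 1" and "p = q / (q - 1)"
  shows "(signed_local_martingale_measures M F S \<inter> Lp_space M q \<noteq> {} \<longleftrightarrow>
            (\<lambda>_. 1) \<notin> K0_bar M F S p) \<and>
         (signed_local_martingale_measures M F S \<inter> Lp_space M q \<noteq> {} \<longrightarrow>
            (\<exists>f. closest_to_one M p (K0_bar M F S p) f) \<and>
            (\<forall>f f'. closest_to_one M p (K0_bar M F S p) f \<longrightarrow>
                    closest_to_one M p (K0_bar M F S p) f' \<longrightarrow> (AE \<omega> in M. f \<omega> = f' \<omega>)) \<and>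
            (\<forall>f. closest_to_one M p (K0_bar M F S p) f \<longrightarrow>
               (let g = g_star p f; u = (\<lambda>\<omega>. g \<omega> / (\<integral>\<omega>'. g \<omega>' \<partial>M)) in
                 integrable M g \<and> (\<integral>\<omega>. g \<omega> \<partial>M) \<noteq> 0 \<and>
                 unique_min_Lp_norm M q
                   {v \<in> Lq_annihilator M q (K0_bar M F S p). (\<integral>\<omega>. v \<omega> \<partial>M) = 1} u \<and>
                 unique_min_Lp_norm M q
                   (signed_local_martingale_measures M F S \<inter> Lp_space M q) u)))"
proof -
  interpret filtered_prob_space M F by fact
  have "1 < p" using assms(5,6) by (simp add: pos_less_divide_eq)
  moreover have "1 / p + 1 / q = 1"
    using assms(5) by (simp add: assms(6) add_divide_distrib[symmetric])
  ultimately interpret conjugate_exponents M p q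
    using assms(5) by unfold_locales
  let ?K = "K0_bar M F S p"
  have p0: "0 < p" using p by simp
  have KL: "K0 M F S \<subseteq> Lp_space M p"
    using assms(2,3) p0 by (intro K0_subset_Lp_space) auto
  have K: "linear_subspace ?K" "Lp_closed M p ?K"
    unfolding K0_bar_def using linear_subspace_linear_span[of "simple_integrals M F S"]
    by (intro linear_subspace_Lp_closure Lp_closed_Lp_closure p0 KL; simp add: K0_def)+
  \<comment> \<open>One inclusion extends annihilation from \<open>K0\<close> to its closure by
    continuity of the pairing; the other restricts it to \<open>K0\<close> and uses that L^q is
    contained in L^1.\<close>
  have measures: "signed_local_martingale_measures M F S \<inter> Lp_space M q = normalized_annihilator ?K"
  proof (intro equalityI subsetI)
    fix u assume "u \<in> signed_local_martingale_measures M F S \<inter> Lp_space M q"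
    then show "u \<in> normalized_annihilator ?K"
      using annihilates_Lp_closure[of u "K0 M F S"]
      by (auto simp: signed_local_martingale_measures_def normalized_annihilator_def
          Lq_annihilator_def K0_bar_def)
  next
    fix u assume "u \<in> normalized_annihilator ?K"
    then show "u \<in> signed_local_martingale_measures M F S \<inter> Lp_space M q"
      using subset_Lp_closure[OF p0 KL] Lp_space_imp_integrable[OF q, of u]
      by (auto simp: signed_local_martingale_measures_def normalized_annihilator_def
          Lq_annihilator_def K0_bar_def)
  qed
  have integrable: "integrable M (g_star p f)" if "closest_to_one M p ?K f" for f
    using g_star_annihilates[OF K that] by (intro Lp_space_imp_integrable[OF q]) (simp add: Lq_annihilator_def)
  show ?thesis
    \<comment> \<open>After this rewriting (a) is trivial, the hypothesis of (b) reads
      \<open>1 \<notin> K\<close>, and the two minimality claims are the same goal.\<close>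
    unfolding measures normalized_annihilator_nonempty_iff[OF K] Let_def
      normalized_annihilator_def[symmetric]
  proof (intro conjI impI allI refl)
    assume one: "(\<lambda>_. 1) \<notin> ?K"
    show "\<exists>f. closest_to_one M p ?K f"
      by (rule closest_to_one_exists[OF K])
    fix f assume f: "closest_to_one M p ?K f"
    show "AE \<omega> in M. f \<omega> = f' \<omega>" if "closest_to_one M p ?K f'" for f'
      by (rule closest_to_one_unique[OF K f that])
    show "integrable M (g_star p f)" by (rule integrable[OF f])
    show "(\<integral>\<omega>. g_star p f \<omega> \<partial>M) \<noteq> 0"
      using integral_g_star_pos[OF K f one] by simp
    show "unique_min_Lp_norm M q (normalized_annihilator ?K)
        (\<lambda>\<omega>. g_star p f \<omega> / (\<integral>\<omega>'. g_star p f \<omega>' \<partial>M))"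
      "unique_min_Lp_norm M q (normalized_annihilator ?K)
        (\<lambda>\<omega>. g_star p f \<omega> / (\<integral>\<omega>'. g_star p f \<omega>' \<partial>M))"
      by (rule normalized_g_star_minimal[OF K f one])+
  qed
qed

end
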